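(* For $n\geqslant3$, the semigroup $\mathcal{OP}_n$ has exactly $$3n + \sum_{k=2}^{n}\sum_{i=1}^{n-k+1}i^{2}\binom{n-i+k-2}{2k-3}\left(F_{2k-1}+F_{2k+1}-k^2+k-2\right)$$ (semigroup) endomorphisms.
   Context: Let $\Omega_n=\{1<2<\cdots<n\}$. A sequence $(a_1,\ldots,a_t)$ in $\Omega_n$ is cyclic if there is at most one index $i\in\{1,\ldots,t\}$ with $a_i>a_{i+1}$, where $a_{t+1}=a_1$. $\mathcal{OP}_n$ is the monoid (under composition) of all full transformations $\alpha$ of $\Omega_n$ that are orientation-preserving, i.e. such that the sequence $(1\alpha,2\alpha,\ldots,n\alpha)$ is cyclic. $F_i$ denotes the $i$th Fibonacci number ($F_0=0$, $F_1=F_2=1$). *)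

theory Defs
  imports "HOL-Algebra.Group" "HOL-Number_Theory.Fib"
begin

definition cyclic_seq :: "nat \<Rightarrow> (nat \<Rightarrow> nat) \<Rightarrow> bool" where
  "cyclic_seq t a \<longleftrightarrow> card {i \<in> {1..t}. a i > a (if i = t then 1 else i + 1)} \<le> 1"

text \<open>
  Transformations of \<open>{1..n}\<close> are extensional functions, so that equality of transformations is
  equality of HOL functions.  Transformations act on the right: the product of \<open>\<alpha>\<close> and \<open>\<beta>\<close>
  applies \<open>\<alpha>\<close> first.
\<close>

definition OP :: "nat \<Rightarrow> (nat \<Rightarrow> nat) monoid" where
  "OP n = \<lparr>carrier = {\<alpha> \<in> {1..n} \<rightarrow>\<^sub>E {1..n}. cyclic_seq n \<alpha>},
           mult = (\<lambda>\<alpha> \<beta>. compose {1..n} \<beta> \<alpha>),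
           one = (\<lambda>x\<in>{1..n}. x)\<rparr>"

text \<open>
  \<^const>\<open>hom\<close> requires only that products are preserved, not the identity element.  Its members are
  arbitrary outside the carrier; extensionality makes each endomorphism be counted once.
\<close>

definition semigroup_endos :: "('a, 'b) monoid_scheme \<Rightarrow> ('a \<Rightarrow> 'a) set" where
  "semigroup_endos S = hom S S \<inter> extensional (carrier S)"

end

theory Submission
  imports Defs "HOL-Library.Infinite_Set"
begin

text \<open>
  A transformation is orientation-preserving iff it is induced modulo \<open>n\<close> by a monotone
  \<open>F :: int \<Rightarrow> int\<close> with \<open>F (z + n) = F z + n\<close>. This makes closure under composition immediate and
  shows that a member of \<open>OP n\<close> which permutes a set \<open>P\<close> and fixes a point of \<open>P\<close> is the identity
  on \<open>P\<close>.

  Let \<open>\<phi>\<close> be an endomorphism. If \<open>\<phi>\<close> is injective on the constants, then the images of the rotations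
  act freely, which forces \<open>\<phi>\<close> to map constants to constants; so \<open>\<phi>\<close> is conjugation by a permutation
  \<open>\<theta>\<close>, and moving a single point to its neighbour shows that \<open>\<theta>\<close> preserves adjacency, i.e. is
  dihedral: \<open>2n\<close> endomorphisms. Otherwise all constants go to one idempotent \<open>f\<close>, whose points are
  fixed by the whole image, so the rotations act as \<open>e = \<phi> 1\<close>. The maps moving a single point to its
  neighbour are conjugate under rotations and have a constant as product, so they all go to \<open>f\<close>, and
  with them every non-injective transformation. Such endomorphisms correspond to pairs of
  idempotents \<open>f \<le> e\<close>, and for \<open>e\<close> of rank \<open>k\<close> the idempotents below \<open>e\<close> correspond to those of \<open>OP k\<close>.
\<close>

section \<open>Degree-one lifts\<close>

text \<open>Residues modulo \<open>n\<close> are represented in \<open>{1..n}\<close>, hence the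
  shift by one around \<open>mod\<close>; the integers then act as the universal cover of the cycle
  of \<open>n\<close> points.\<close>

definition wrap :: "nat \<Rightarrow> int \<Rightarrow> nat" where
  "wrap n z = nat ((z - 1) mod int n) + 1"

lemma wrap_in [simp]:
  assumes "n > 0"
  shows "wrap n z \<in> {1..n}"
proof -
  have "(z - 1) mod int n < int n" "(z - 1) mod int n \<ge> 0"
    using assms by auto
  then show ?thesis
    by (auto simp: wrap_def)
qed

lemma wrap_of_nat [simp]:
  assumes "x \<in> {1..n}"
  shows "wrap n (int x) = x"
proof -
  have "(int x - 1) mod int n = int x - 1"
    using assms by (intro mod_pos_pos_trivial) auto
  then show ?thesis
    using assms by (auto simp: wrap_def)
qed

lemma wrap_add_mult [simp]: "wrap n (z + q * int n) = wrap n z"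
proof -
  have "(z + q * int n - 1) mod int n = (z - 1 + q * int n) mod int n"
    by (simp add: algebra_simps)
  then show ?thesis
    by (simp add: wrap_def)
qed

lemma wrap_shift [simp]: "wrap n (z + int n) = wrap n z" "wrap n (z - int n) = wrap n z"
  using wrap_add_mult[of n z 1] wrap_add_mult[of n z "-1"] by auto

lemma wrap_decomp:
  assumes "n > 0"
  shows "z = int (wrap n z) + (z - 1) div int n * int n"
proof -
  have "int (wrap n z) = (z - 1) mod int n + 1"
    using assms by (simp add: wrap_def)
  then show ?thesis
    using div_mult_mod_eq[of "z - 1" "int n"] by linarith
qed

lemma wrap_eqE:
  assumes "n > 0" "wrap n z = wrap n w"
  obtains q where "w = z + q * int n"
proof
  show "w = z + ((w - 1) div int n - (z - 1) div int n) * int n"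
    using wrap_decomp[OF assms(1), of z] wrap_decomp[OF assms(1), of w] assms(2)
    by (simp add: algebra_simps)
qed

text \<open>A multiple of \<open>n\<close> of absolute value below \<open>n\<close> is zero.
  Congruences between lift values are turned into equalities this way throughout.\<close>

lemma wrap_eq_window:
  assumes "n > 0" "wrap n z = wrap n w" "\<bar>z - w\<bar> < int n"
  shows "z = w"
proof -
  obtain q where q: "w = z + q * int n"
    using wrap_eqE assms(1,2) by blast
  have "\<bar>q\<bar> * int n < 1 * int n"
    using assms(3) q by (simp add: abs_mult)
  then have "\<bar>q\<bar> < 1"
    by (subst (asm) mult_less_cancel_right) (use assms(1) in auto)
  then show ?thesis
    using q by simp
qed

lemma wrap_window_rep:
  assumes "n > 0" "x \<in> {1..n}"
  obtains z where "a \<le> z" "z < a + int n" "wrap n z = x"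
proof
  let ?r = "(int x - a) mod int n"
  show "a \<le> a + ?r" "a + ?r < a + int n"
    using assms(1) by auto
  have "a + ?r = int x + (- ((int x - a) div int n)) * int n"
    using div_mult_mod_eq[of "int x - a" "int n"] by (simp add: algebra_simps)
  then show "wrap n (a + ?r) = x"
    using assms(2) by (metis wrap_add_mult wrap_of_nat)
qed

text \<open>Two cycle lengths are allowed because numbering the image of an idempotent later relates
  cycles of different sizes. One turn of the first cycle advances the lift by exactly one turn of
  the second, even for a constant map.\<close>

definition is_lift :: "nat \<Rightarrow> nat \<Rightarrow> (int \<Rightarrow> int) \<Rightarrow> (nat \<Rightarrow> nat) \<Rightarrow> bool" where
  "is_lift n m F \<alpha> \<longleftrightarrow> mono F \<and> (\<forall>z. F (z + int n) = F z + int m) \<and>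
     (\<forall>x\<in>{1..n}. \<alpha> x = wrap m (F (int x)))"

lemma is_lift_add_mult:
  assumes "is_lift n m F \<alpha>"
  shows "F (z + q * int n) = F z + q * int m"
proof (induction q rule: int_induct[where k = 0])
  case base
  then show ?case by simp
next
  case (step1 i)
  have "F (z + (i + 1) * int n) = F (z + i * int n + int n)"
    by (simp add: algebra_simps)
  also have "\<dots> = F (z + i * int n) + int m"
    using assms unfolding is_lift_def by blast
  finally show ?case
    using step1 by (simp add: algebra_simps)
next
  case (step2 i)
  have "F (z + (i - 1) * int n + int n) = F (z + (i - 1) * int n) + int m"
    using assms unfolding is_lift_def by blast
  moreover have "z + (i - 1) * int n + int n = z + i * int n"
    by (simp add: algebra_simps)
  ultimately show ?case
    using step2 by (simp add: algebra_simps)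
qed

lemma is_liftD:
  assumes "is_lift n m F \<alpha>"
  shows "z \<le> w \<Longrightarrow> F z \<le> F w" "F (z + int n) = F z + int m"
  using assms by (auto simp: is_lift_def mono_def)

lemma is_lift_wrap:
  assumes "is_lift n m F \<alpha>" "n > 0"
  shows "\<alpha> (wrap n z) = wrap m (F z)"
proof -
  have "F z = F (int (wrap n z)) + (z - 1) div int n * int m"
    using is_lift_add_mult[OF assms(1), of "int (wrap n z)"] wrap_decomp[OF assms(2), of z] by metis
  then show ?thesis
    using assms wrap_in[OF assms(2), of z] by (auto simp: is_lift_def)
qed

text \<open>Lifts may be translated by multiples of \<open>m\<close>, so the value at a single point
  can be prescribed within its residue class.\<close>

lemma is_lift_through:
  assumes "is_lift n m F \<alpha>" "n > 0" "m > 0" "\<alpha> (wrap n z) = wrap m w"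
  obtains G where "is_lift n m G \<alpha>" "G z = w"
proof -
  have "wrap m (F z) = wrap m w"
    using is_lift_wrap assms by metis
  then obtain q where q: "w = F z + q * int m"
    using wrap_eqE assms(3) by blast
  show thesis
  proof
    show "is_lift n m (\<lambda>z. F z + q * int m) \<alpha>"
      using assms(1) by (auto simp: is_lift_def mono_def)
  qed (use q in auto)
qed

lemma is_lift_comp:
  assumes "is_lift n m F \<alpha>" "is_lift m l G \<beta>" "m > 0" "\<And>x. x \<in> {1..n} \<Longrightarrow> \<gamma> x = \<beta> (\<alpha> x)"
  shows "is_lift n l (G \<circ> F) \<gamma>"
  unfolding is_lift_def
proof (intro conjI allI ballI)
  show "mono (G \<circ> F)"
    using assms(1,2) by (auto simp: is_lift_def mono_def)
  show "(G \<circ> F) (z + int n) = (G \<circ> F) z + int l" for z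
    using assms(1,2) by (auto simp: is_lift_def)
  show "\<gamma> x = wrap l ((G \<circ> F) (int x))" if "x \<in> {1..n}" for x
    using that assms is_lift_wrap[OF assms(2,3)] by (auto simp: is_lift_def)
qed

lemma is_lift_cong:
  assumes "is_lift n m F \<alpha>" "\<And>x. x \<in> {1..n} \<Longrightarrow> \<beta> x = \<alpha> x"
  shows "is_lift n m F \<beta>"
  using assms by (auto simp: is_lift_def)

lemma mono_int_iff_step: "mono (F :: int \<Rightarrow> int) \<longleftrightarrow> (\<forall>z. F z \<le> F (z + 1))"
proof
  assume *: "\<forall>z. F z \<le> F (z + 1)"
  have "F z \<le> F w" if "z \<le> w" for z w
    using that
  proof (induction w rule: int_ge_induct)
    case (step i)
    then show ?case
      using * order_trans by blast
  qed auto
  then show "mono F"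
    by (simp add: mono_def)
qed (auto simp: mono_def)

text \<open>A sequence that descends only after position \<open>j\<close> becomes monotone once a
  full turn \<open>m\<close> is added to everything beyond \<open>j\<close>. With
  \<open>n \<le> j\<close> the turn happens at the closing step from \<open>n\<close> to
  \<open>1\<close>, where values in \<open>{1..m}\<close> never fall by as much as
  \<open>m\<close>.\<close>

lemma split_seq_has_lift:
  assumes n: "n > 0" and m: "m > 0" and into: "\<And>x. x \<in> {1..n} \<Longrightarrow> \<alpha> x \<in> {1..m}"
    and ascend: "\<And>x. x \<in> {1..<n} \<Longrightarrow> x \<noteq> j \<Longrightarrow> \<alpha> x \<le> \<alpha> (x + 1)"
    and close: "j < n \<Longrightarrow> \<alpha> n \<le> \<alpha> 1"
  shows "\<exists>F. is_lift n m F \<alpha>"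
proof -
  define F where "F z = int (\<alpha> (wrap n z)) +
    int m * ((z - 1) div int n + (if wrap n z > j then 1 else 0))" for z
  have per: "F (z + int n) = F z + int m" for z
  proof -
    have "(z + int n - 1) div int n = (z - 1) div int n + 1"
      using n div_add_self2[of "int n" "z - 1"] by (simp add: algebra_simps)
    then show ?thesis
      by (simp add: F_def algebra_simps)
  qed
  have bd: "int (\<alpha> x) \<le> int m" "1 \<le> int (\<alpha> x)" if "x \<in> {1..n}" for x
    using into[OF that] by auto
  have step: "F z \<le> F (z + 1)" for z
  proof (cases "wrap n z = n")
    case True
    have z: "z = int n + (z - 1) div int n * int n"
      using wrap_decomp[OF n, of z] True by simp
    define q where "q = (z - 1) div int n"
    have z': "z + 1 = 1 + (q + 1) * int n"
      using z unfolding q_def[symmetric] by (simp add: algebra_simps)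
    have "wrap n (z + 1) = 1"
      unfolding z' wrap_add_mult using n wrap_of_nat[of 1 n] by simp
    moreover have "(z + 1 - 1) div int n = q + 1"
      unfolding z' using n by simp
    ultimately have "F (z + 1) = int (\<alpha> 1) + int m * (q + 1 + (if 1 > j then 1 else 0))"
      by (simp add: F_def)
    moreover have "F z = int (\<alpha> n) + int m * (q + (if n > j then 1 else 0))"
      by (simp add: F_def True q_def)
    ultimately show ?thesis
      using close bd[of 1] bd[of n] n by (auto simp: algebra_simps)
  next
    case False
    define x where "x = wrap n z"
    have x: "x \<in> {1..<n}"
      using wrap_in[OF n, of z] False unfolding x_def by simp
    define q where "q = (z - 1) div int n"
    have z: "z = int x + q * int n"
      unfolding x_def q_def using wrap_decomp[OF n] by blast
    have z': "z + 1 = int (x + 1) + q * int n"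
      using z by simp
    have w: "wrap n (z + 1) = x + 1"
      unfolding z' wrap_add_mult using x by (intro wrap_of_nat) auto
    have "(z + 1 - 1) div int n = q"
      unfolding z using x n by (simp add: div_pos_pos_trivial)
    then have "F (z + 1) = int (\<alpha> (x + 1)) + int m * (q + (if x + 1 > j then 1 else 0))"
      by (simp add: F_def w)
    moreover have "F z = int (\<alpha> x) + int m * (q + (if x > j then 1 else 0))"
      by (simp add: F_def q_def x_def)
    ultimately show ?thesis
      using ascend[of x] x bd[of x] bd[of "x + 1"] by (auto simp: algebra_simps)
  qed
  have "is_lift n m F \<alpha>"
    unfolding is_lift_def mono_int_iff_step
  proof (intro conjI allI ballI)
    fix x assume x: "x \<in> {1..n}"
    have "(int x - 1) div int n = 0"
      using x by (intro div_pos_pos_trivial) auto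
    then have "F (int x) = int (\<alpha> x) + (if x > j then 1 else 0) * int m"
      using x by (simp add: F_def)
    then show "\<alpha> x = wrap m (F (int x))"
      using into[OF x] by (simp only: wrap_add_mult wrap_of_nat)
  qed (use step per in auto)
  then show ?thesis by blast
qed

lemma mono_on_has_lift:
  assumes "n > 0" "m > 0" "\<And>x. x \<in> {1..n} \<Longrightarrow> \<alpha> x \<in> {1..m}" "mono_on {1..n} \<alpha>"
  shows "\<exists>F. is_lift n m F \<alpha>"
  using assms(1-3)
proof (rule split_seq_has_lift[where j = n])
  show "\<alpha> x \<le> \<alpha> (x + 1)" if "x \<in> {1..<n}" for x
    using that by (intro mono_onD[OF assms(4)]) auto
qed auto

text \<open>The endpoints of a lift with value in \<open>{1..n}\<close> at \<open>1\<close> differ by \<open>n\<close>, so only one step of it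
  crosses from \<open>{1..n}\<close> to \<open>{n+1..2n}\<close>; a descent of the sequence is such a crossing.\<close>

lemma cyclic_seq_iff_has_lift:
  assumes n: "n > 0" and into: "\<And>x. x \<in> {1..n} \<Longrightarrow> \<alpha> x \<in> {1..n}"
  shows "cyclic_seq n \<alpha> \<longleftrightarrow> (\<exists>F. is_lift n n F \<alpha>)"
proof
  define D where "D = {i \<in> {1..n}. \<alpha> i > \<alpha> (if i = n then 1 else i + 1)}"
  have fin: "finite D"
    by (simp add: D_def)
  {
    assume "cyclic_seq n \<alpha>"
    then have "card D \<le> Suc 0"
      by (simp add: cyclic_seq_def D_def)
    then have one: "i = i'" if "i \<in> D" "i' \<in> D" for i i'
      using that card_le_Suc0_iff_eq[OF fin] by blast
    \<comment> \<open>Without a descent any \<open>j\<close> serves.\<close>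
    then obtain j where j: "\<And>i. i \<in> D \<Longrightarrow> i = j"
      by metis
    show "\<exists>F. is_lift n n F \<alpha>"
    proof (rule split_seq_has_lift[where j = j, OF n n into])
      show "\<alpha> x \<le> \<alpha> (x + 1)" if "x \<in> {1..<n}" "x \<noteq> j" for x
        using j[of x] that by (cases "\<alpha> (x + 1) < \<alpha> x") (auto simp: D_def)
      show "\<alpha> n \<le> \<alpha> 1" if "j < n"
        using j[of n] that n by (cases "\<alpha> 1 < \<alpha> n") (auto simp: D_def)
    qed
  }
  assume "\<exists>F. is_lift n n F \<alpha>"
  moreover have "\<alpha> (wrap n 1) = wrap n (int (\<alpha> 1))"
    using n into[of 1] wrap_of_nat[of 1 n] by simp
  ultimately obtain F where F: "is_lift n n F \<alpha>" and F1: "F 1 = int (\<alpha> 1)"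
    using is_lift_through n by metis
  have Fn: "F (int n + 1) = int (\<alpha> 1) + int n"
    using is_liftD(2)[OF F, of 1] F1 by (simp add: add.commute)
  have cross: "F (int i) \<le> int n" "int n < F (int i + 1)" if "i \<in> D" for i
  proof -
    have i: "i \<in> {1..n}" and desc: "\<alpha> i > \<alpha> (if i = n then 1 else i + 1)"
      using that by (auto simp: D_def)
    have a: "wrap n (F (int i)) = \<alpha> i"
      using is_lift_wrap[OF F n, of "int i"] i by simp
    have b: "wrap n (F (int i + 1)) = \<alpha> (if i = n then 1 else i + 1)"
    proof (cases "i = n")
      case True
      have "\<alpha> 1 \<in> {1..n}"
        using into[of 1] n by simp
      then show ?thesis
        using True Fn by (simp only: wrap_shift wrap_of_nat simp_thms if_True)
    next
      case False
      then have "wrap n (int (i + 1)) = i + 1"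
        using i by (intro wrap_of_nat) auto
      then show ?thesis
        using is_lift_wrap[OF F n, of "int (i + 1)"] False by (simp add: add.commute)
    qed
    have le: "F 1 \<le> F (int i)" "F (int i) \<le> F (int i + 1)" "F (int i + 1) \<le> F (int n + 1)"
      using i by (auto intro!: is_liftD(1)[OF F])
    have \<alpha>1: "1 \<le> \<alpha> 1" "\<alpha> 1 \<le> n"
      using into[of 1] n by auto
    have low: "int (wrap n z) = z" if "1 \<le> z" "z \<le> int n" for z
      using wrap_of_nat[of "nat z" n] that by (simp add: nat_le_iff Suc_le_eq)
    have high: "int (wrap n z) = z - int n" if "int n < z" "z \<le> 2 * int n" for z
      using low[of "z - int n"] that by simp
    \<comment> \<open>Within one block \<open>{1..n}\<close> or \<open>{n+1..2n}\<close> passing to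
      residues keeps the order, so monotonicity of \<open>F\<close> would exclude the
      descent.\<close>
    have "\<not> (F (int i + 1) \<le> int n)"
      using low[of "F (int i)"] low[of "F (int i + 1)"] le desc a b F1 \<alpha>1 by linarith
    moreover have "\<not> (int n < F (int i))"
      using high[of "F (int i)"] high[of "F (int i + 1)"] le desc a b F1 Fn \<alpha>1 by linarith
    ultimately show "F (int i) \<le> int n" "int n < F (int i + 1)"
      by auto
  qed
  have "\<not> i < i'" if "i \<in> D" "i' \<in> D" for i i'
  proof
    assume "i < i'"
    then have "F (int i + 1) \<le> F (int i')"
      by (intro is_liftD(1)[OF F]) auto
    then show False
      using cross[OF that(1)] cross[OF that(2)] by linarith
  qed
  then have "\<forall>i\<in>D. \<forall>i'\<in>D. i = i'"
    by (meson linorder_neqE_nat)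
  then have "card D \<le> Suc 0"
    using card_le_Suc0_iff_eq[OF fin] by blast
  then show "cyclic_seq n \<alpha>"
    by (simp add: cyclic_seq_def D_def)
qed

section \<open>The monoid of orientation-preserving transformations\<close>

lemma carrier_OP_iff:
  assumes "n > 0"
  shows "\<alpha> \<in> carrier (OP n) \<longleftrightarrow> \<alpha> \<in> {1..n} \<rightarrow>\<^sub>E {1..n} \<and> (\<exists>F. is_lift n n F \<alpha>)"
proof (cases "\<alpha> \<in> {1..n} \<rightarrow>\<^sub>E {1..n}")
  case True
  then have "cyclic_seq n \<alpha> \<longleftrightarrow> (\<exists>F. is_lift n n F \<alpha>)"
    by (intro cyclic_seq_iff_has_lift[OF assms]) (rule PiE_mem)
  with True show ?thesis
    by (simp add: OP_def)
qed (auto simp: OP_def)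

lemma OP_liftE:
  assumes "n > 0" "\<alpha> \<in> carrier (OP n)" "\<alpha> (wrap n z) = wrap n w"
  obtains F where "is_lift n n F \<alpha>" "F z = w"
proof -
  obtain F where "is_lift n n F \<alpha>"
    using carrier_OP_iff[OF assms(1)] assms(2) by blast
  then show thesis
    using is_lift_through[of n n F \<alpha> z w] assms that by blast
qed

lemma OP_mem:
  assumes "\<alpha> \<in> carrier (OP n)" "x \<in> {1..n}"
  shows "\<alpha> x \<in> {1..n}"
  using assms by (auto simp: OP_def PiE_mem)

lemma OP_ext:
  assumes "\<alpha> \<in> carrier (OP n)" "\<beta> \<in> carrier (OP n)" "\<And>x. x \<in> {1..n} \<Longrightarrow> \<alpha> x = \<beta> x"
  shows "\<alpha> = \<beta>"
  using assms by (intro PiE_ext[of \<alpha> "{1..n}" "\<lambda>_. {1..n}"]) (auto simp: OP_def)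

lemma OP_mult: "\<alpha> \<otimes>\<^bsub>OP n\<^esub> \<beta> = compose {1..n} \<beta> \<alpha>"
  by (simp add: OP_def)

lemma OP_mult_apply [simp]: "x \<in> {1..n} \<Longrightarrow> (\<alpha> \<otimes>\<^bsub>OP n\<^esub> \<beta>) x = \<beta> (\<alpha> x)"
  by (simp add: OP_mult compose_eq)

lemma restrict_in_OP:
  assumes "n > 0" "is_lift n n F \<alpha>"
  shows "restrict \<alpha> {1..n} \<in> carrier (OP n)"
proof -
  have "restrict \<alpha> {1..n} \<in> {1..n} \<rightarrow>\<^sub>E {1..n}"
  proof (rule restrict_PiE_iff[THEN iffD2], rule ballI)
    show "\<alpha> x \<in> {1..n}" if "x \<in> {1..n}" for x
      using that assms wrap_in[OF assms(1)] by (auto simp: is_lift_def)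
  qed
  moreover have "is_lift n n F (restrict \<alpha> {1..n})"
    using assms(2) by (rule is_lift_cong) auto
  ultimately show ?thesis
    using carrier_OP_iff[OF assms(1)] by blast
qed

lemma monoid_OP:
  assumes "n > 0"
  shows "monoid (OP n)"
proof
  have id: "is_lift n n (\<lambda>z. z) (\<lambda>x. x)"
    by (auto simp: is_lift_def mono_def)
  then show "\<one>\<^bsub>OP n\<^esub> \<in> carrier (OP n)"
    using restrict_in_OP[OF assms id] by (simp add: OP_def)
  fix \<alpha> \<beta> assume \<alpha>: "\<alpha> \<in> carrier (OP n)" and \<beta>: "\<beta> \<in> carrier (OP n)"
  obtain F G where "is_lift n n F \<alpha>" "is_lift n n G \<beta>"
    using \<alpha> \<beta> carrier_OP_iff[OF assms] by blast
  then have "is_lift n n (G \<circ> F) (\<lambda>x. \<beta> (\<alpha> x))"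
    by (rule is_lift_comp) (use assms in auto)
  then show "\<alpha> \<otimes>\<^bsub>OP n\<^esub> \<beta> \<in> carrier (OP n)"
    using restrict_in_OP[OF assms] by (simp add: OP_mult compose_def)
next
  fix \<alpha> \<beta> \<gamma> assume "\<alpha> \<in> carrier (OP n)" "\<beta> \<in> carrier (OP n)" "\<gamma> \<in> carrier (OP n)"
  then have "\<alpha> \<in> {1..n} \<rightarrow> {1..n}"
    by (auto simp: OP_def)
  then show "\<alpha> \<otimes>\<^bsub>OP n\<^esub> \<beta> \<otimes>\<^bsub>OP n\<^esub> \<gamma> = \<alpha> \<otimes>\<^bsub>OP n\<^esub> (\<beta> \<otimes>\<^bsub>OP n\<^esub> \<gamma>)"
    unfolding OP_mult by (rule compose_assoc)
next
  fix \<alpha> assume "\<alpha> \<in> carrier (OP n)"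
  then have \<alpha>: "\<alpha> \<in> {1..n} \<rightarrow> {1..n}" "\<alpha> \<in> extensional {1..n}"
    by (auto simp: OP_def PiE_def)
  show "\<one>\<^bsub>OP n\<^esub> \<otimes>\<^bsub>OP n\<^esub> \<alpha> = \<alpha>"
    unfolding OP_mult using compose_Id[OF \<alpha>] by (simp add: OP_def)
  show "\<alpha> \<otimes>\<^bsub>OP n\<^esub> \<one>\<^bsub>OP n\<^esub> = \<alpha>"
    unfolding OP_mult using Id_compose[OF \<alpha>] by (simp add: OP_def)
qed

lemma OP_one_apply [simp]: "x \<in> {1..n} \<Longrightarrow> \<one>\<^bsub>OP n\<^esub> x = x"
  by (simp add: OP_def)

lemma finite_OP: "finite (carrier (OP n))"
proof (rule finite_subset)
  show "carrier (OP n) \<subseteq> {1..n} \<rightarrow>\<^sub>E {1..n}"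
    by (auto simp: OP_def)
qed (simp add: finite_PiE)

section \<open>Constants, rotations and one-point pushes\<close>

definition const_map :: "nat \<Rightarrow> nat \<Rightarrow> nat \<Rightarrow> nat" where
  "const_map n y = (\<lambda>x\<in>{1..n}. y)"

definition rot :: "nat \<Rightarrow> int \<Rightarrow> nat \<Rightarrow> nat" where
  "rot n j = (\<lambda>x\<in>{1..n}. wrap n (int x + j))"

text \<open>For \<open>n > 1\<close> these are non-injective with the largest possible image. They
  test adjacency under an endomorphism and, multiplied together, reach a constant.\<close>

definition push :: "nat \<Rightarrow> nat \<Rightarrow> nat \<Rightarrow> nat" where
  "push n a = (\<lambda>x\<in>{1..n}. if x = a then wrap n (int a + 1) else x)"

lemma mono_restrict_in_OP:
  assumes "n > 0" "\<And>x. x \<in> {1..n} \<Longrightarrow> \<alpha> x \<in> {1..n}" "mono_on {1..n} \<alpha>"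
  shows "restrict \<alpha> {1..n} \<in> carrier (OP n)"
  using mono_on_has_lift[OF assms(1,1), of \<alpha>] assms restrict_in_OP by blast

lemma const_map_in_OP: "y \<in> {1..n} \<Longrightarrow> const_map n y \<in> carrier (OP n)"
  unfolding const_map_def by (rule mono_restrict_in_OP) (auto intro: mono_onI)

lemma rot_in_OP: "n > 0 \<Longrightarrow> rot n j \<in> carrier (OP n)"
  unfolding rot_def
  by (rule restrict_in_OP[where F = "\<lambda>z. z + j"]) (auto simp: is_lift_def mono_def)

lemma push_in_OP:
  assumes "n > 0" 
  shows "push n a \<in> carrier (OP n)"
  unfolding push_def
\<comment> \<open>The lift moves the whole residue class of \<open>a\<close> up by one; the next
  integer is never overtaken, so monotonicity survives.\<close>
proof (rule restrict_in_OP[where F = "\<lambda>z. if wrap n z = a then z + 1 else z", OF assms])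
  show "is_lift n n (\<lambda>z. if wrap n z = a then z + 1 else z)
     (\<lambda>x. if x = a then wrap n (int a + 1) else x)"
    unfolding is_lift_def mono_int_iff_step by auto
qed

text \<open>With the right action, constants are right zeros and right multiplication moves them
  exactly as \<open>\<alpha>\<close> moves points. So the action on points can be read off inside
  the abstract monoid.\<close>

lemma const_map_mult:
  assumes "n > 0" "\<alpha> \<in> carrier (OP n)" "y \<in> {1..n}"
  shows "const_map n y \<otimes>\<^bsub>OP n\<^esub> \<alpha> = const_map n (\<alpha> y)" 
    and "\<alpha> \<otimes>\<^bsub>OP n\<^esub> const_map n y = const_map n y"
proof -
  have "const_map n y (\<alpha> x) = y" if "x \<in> {1..n}" for x
    using OP_mem[OF assms(2) that] by (simp add: const_map_def)
  then show "\<alpha> \<otimes>\<^bsub>OP n\<^esub> const_map n y = const_map n y"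
    unfolding OP_mult compose_def const_map_def[of n y]
    by (intro restrict_ext) (simp add: const_map_def)
qed (auto simp: OP_mult compose_def const_map_def)

lemma rot_mult:
  assumes "n > 0"
  shows "rot n i \<otimes>\<^bsub>OP n\<^esub> rot n j = rot n (i + j)"
proof -
  have "wrap n (int (wrap n (int x + i)) + j) = wrap n (int x + (i + j))" for x
    using wrap_decomp[OF assms, of "int x + i"]
      wrap_add_mult[of n "int (wrap n (int x + i)) + j" "(int x + i - 1) div int n"]
    by (simp add: algebra_simps)
  then show ?thesis
    using wrap_in[OF assms] by (auto simp: OP_mult compose_def rot_def intro!: restrict_ext)
qed

lemma rot_0: "rot n 0 = \<one>\<^bsub>OP n\<^esub>"
  by (auto simp: rot_def OP_def intro!: restrict_ext)

text \<open>A lift fixing \<open>y\<close> permutes increasingly the finitely many points over \<open>P\<close> in the window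
  \<open>{y..<y + n}\<close>.\<close>

lemma OP_perm_fixing_point:
  assumes n: "n > 0" and \<alpha>: "\<alpha> \<in> carrier (OP n)" and P: "P \<subseteq> {1..n}"
    and into: "\<alpha> ` P \<subseteq> P" and inj: "inj_on \<alpha> P" and y: "y \<in> P" "\<alpha> y = y" and x: "x \<in> P"
  shows "\<alpha> x = x"
proof -
  have yn: "y \<in> {1..n}"
    using y P by auto
  obtain F where F: "is_lift n n F \<alpha>" and Fy: "F (int y) = int y"
    using OP_liftE[OF n \<alpha>, of "int y" "int y"] y yn by auto
  note Fw = is_lift_wrap[OF F n]
  define Q where "Q = {z. int y \<le> z \<and> z < int y + int n \<and> wrap n z \<in> P}"
  have finQ: "finite Q"
    by (rule finite_subset[of _ "{int y..int y + int n}"]) (auto simp: Q_def)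
  have eqQ: "z = w" if "z \<in> Q" "w \<in> Q" "wrap n z = wrap n w" for z w
    using that by (intro wrap_eq_window[OF n]) (auto simp: Q_def)
  have inj': "z = w" if "z \<in> Q" "w \<in> Q" "F z = F w" for z w
  proof (rule eqQ[OF that(1,2)])
    have "\<alpha> (wrap n z) = \<alpha> (wrap n w)"
      using Fw that(3) by simp
    then show "wrap n z = wrap n w"
      using that inj by (auto simp: Q_def dest: inj_onD)
  qed
  have yQ: "int y \<in> Q"
    using y yn n by (simp add: Q_def)
  have intoQ: "F z \<in> Q" if z: "z \<in> Q" for z
  proof -
    have "int y \<le> F z" "F z \<le> int y + int n"
      using is_liftD(1)[OF F, of "int y" z] is_liftD(1)[OF F, of z "int y + int n"]
        is_liftD(2)[OF F, of "int y"] Fy z by (auto simp: Q_def)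
    moreover have "wrap n (F z) \<in> P"
      using Fw z into by (auto simp: Q_def)
    \<comment> \<open>\<open>y + n\<close> lies over the fixed point \<open>y\<close>; injectivity
      on \<open>P\<close> reserves that residue for \<open>y\<close>, whose lift value is
      \<open>y\<close> itself.\<close>
    moreover have "F z \<noteq> int y + int n"
    proof
      assume *: "F z = int y + int n"
      then have "\<alpha> (wrap n z) = \<alpha> (wrap n (int y))"
        using Fw yn y by simp
      then have "wrap n z = wrap n (int y)"
        using inj z y yn by (auto simp: Q_def dest: inj_onD)
      then have "z = int y"
        using eqQ z yQ by blast
      then show False
        using * Fy n by simp
    qed
    ultimately show ?thesis
      by (simp add: Q_def)
  qed
  have surj: "F ` Q = Q"
    using finQ intoQ inj' by (intro endo_inj_surj) (auto intro: inj_onI)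
  have "F z = z" if "z \<in> Q" for z
  proof (rule ccontr)
    assume "F z \<noteq> z"
    define B where "B = {z \<in> Q. F z \<noteq> z}"
    have B: "finite B" "B \<noteq> {}"
      using finQ that \<open>F z \<noteq> z\<close> by (auto simp: B_def)
    \<comment> \<open>The least moved point cannot go down, since its target is already fixed and
      \<open>F\<close> is injective on \<open>Q\<close>; if it goes up, its preimage lies above it,
      against monotonicity.\<close>
    define m where "m = Min B"
    have mB: "m \<in> Q" "F m \<noteq> m"
      using Min_in[OF B] by (auto simp: B_def m_def)
    have least: "F w = w" if "w \<in> Q" "w < m" for w
      using Min_le[OF B(1), of w] that by (force simp: B_def m_def)
    show False
    proof (cases "F m < m")
      case True
      then have "F (F m) = F m"
        using least intoQ mB by blast
      then show False
        using inj'[OF intoQ[OF mB(1)] mB(1)] mB by blast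
    next
      case False
      then have gt: "m < F m"
        using mB by simp
      obtain w where w: "w \<in> Q" "F w = m"
        using surj mB(1) by (metis imageE)
      then have "m < w"
        using least[OF w(1)] mB(2) by (metis linorder_less_linear)
      then show False
        using is_liftD(1)[OF F, of m w] gt w by auto
    qed
  qed
  moreover obtain z where z: "int y \<le> z" "z < int y + int n" "wrap n z = x"
    using wrap_window_rep[OF n, of x] x P by blast
  ultimately show ?thesis
    using Fw[of z] x by (auto simp: Q_def)
qed

text \<open>A lift fixing \<open>b - 1\<close> must also fix \<open>b + 1\<close>, which traps its
  value at \<open>b\<close> between them.\<close>

lemma OP_moving_one_point:
  assumes n: "n > 0" and \<alpha>: "\<alpha> \<in> carrier (OP n)"
    and others: "\<And>x. x \<in> {1..n} \<Longrightarrow> x \<noteq> wrap n b \<Longrightarrow> \<alpha> x = x" and n3: "n \<ge> 3"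
  shows "\<alpha> (wrap n b) \<in> {wrap n (b - 1), wrap n b, wrap n (b + 1)}"
proof -
  have ne: "wrap n (b + i) \<noteq> wrap n b" if "i \<in> {-1, 1}" for i
    using wrap_eq_window[OF n, of "b + i" b] that n3 by auto
  have others': "\<alpha> (wrap n (b + i)) = wrap n (b + i)" if "i \<in> {-1, 1}" for i
    using others ne[OF that] wrap_in[OF n] by blast
  obtain F where F: "is_lift n n F \<alpha>" and F1: "F (b - 1) = b - 1"
    using OP_liftE[OF n \<alpha>, of "b - 1" "b - 1"] others'[of "-1"] by auto
  have "b - 1 \<le> F (b + 1)" "F (b + 1) \<le> b - 1 + int n"
    using is_liftD(1)[OF F, of "b - 1" "b + 1"] is_liftD(1)[OF F, of "b + 1" "b - 1 + int n"]
      is_liftD(2)[OF F, of "b - 1"] F1 n3 by auto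
  moreover have "wrap n (F (b + 1)) = wrap n (b + 1)"
    using is_lift_wrap[OF F n, of "b + 1"] others'[of 1] by simp
  \<comment> \<open>The value lies between \<open>b - 1\<close> and \<open>b - 1 + n\<close>, so it
    differs from \<open>b + 1\<close> by at most \<open>max 2 (n - 2)\<close>, which is below
    \<open>n\<close> because \<open>n \<ge> 3\<close>.\<close>
  ultimately have "F (b + 1) = b + 1"
    by (intro wrap_eq_window[OF n]) (use n3 in auto)
  then have "F b \<in> {b - 1, b, b + 1}"
    using is_liftD(1)[OF F, of "b - 1" b] is_liftD(1)[OF F, of b "b + 1"] F1 by auto
  then show ?thesis
    using is_lift_wrap[OF F n, of b] by auto
qed

text \<open>Two integers less than \<open>n\<close> apart with the same lift value force the
  monotone lift to be constant between them, in particular on the first step.\<close>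

lemma OP_not_inj_adjacent:
  assumes n: "n > 0" and \<alpha>: "\<alpha> \<in> carrier (OP n)" and ni: "\<not> inj_on \<alpha> {1..n}"
  obtains a where "a \<in> {1..n}" "wrap n (int a + 1) \<noteq> a" "\<alpha> (wrap n (int a + 1)) = \<alpha> a"
proof -
  obtain F where F: "is_lift n n F \<alpha>"
    using carrier_OP_iff[OF n] \<alpha> by blast
  note Fw = is_lift_wrap[OF F n]
  obtain x y where xy: "x \<in> {1..n}" "y \<in> {1..n}" "x < y" "\<alpha> x = \<alpha> y"
    using ni by (metis inj_onI linorder_neqE_nat)
  have "wrap n (F (int x)) = wrap n (F (int y))"
    using Fw[of "int x"] Fw[of "int y"] xy by simp
  then obtain q where q: "F (int y) = F (int x) + q * int n"
    using wrap_eqE[OF n] by metis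
  have le: "F (int x) \<le> F (int y)" "F (int y) \<le> F (int x) + int n"
    using is_liftD(1)[OF F, of "int x" "int y"] is_liftD(1)[OF F, of "int y" "int x + int n"]
      is_liftD(2)[OF F, of "int x"] xy by auto
  \<comment> \<open>If the lift values of \<open>x\<close> and \<open>y\<close> differ, they differ
    by a full turn; then the other arc, from \<open>y\<close> to \<open>x + n\<close>, is the
    collapsed one.\<close>
  have "\<exists>z w. z < w \<and> w - z < int n \<and> F z = F w"
  proof (cases "F (int x) = F (int y)")
    case True
    then show ?thesis
      using xy by (intro exI[of _ "int x"] exI[of _ "int y"]) auto
  next
    case False
    then have "q * int n \<noteq> 0" "0 * int n \<le> q * int n" "q * int n \<le> 1 * int n"
      using q le by auto
    then have "q \<noteq> 0" "0 \<le> q" "q \<le> 1"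
      using n mult_le_cancel_right_pos[of "int n"] by (auto simp: zero_le_mult_iff)
    then have "q = 1"
      by simp
    then have "F (int y) = F (int x + int n)"
      using q is_liftD(2)[OF F, of "int x"] by simp
    then show ?thesis
      using xy by (intro exI[of _ "int y"] exI[of _ "int x + int n"]) auto
  qed
  then obtain z w where zw: "z < w" "w - z < int n" "F z = F w"
    by blast
  then have Fz: "F (z + 1) = F z"
    using is_liftD(1)[OF F, of z "z + 1"] is_liftD(1)[OF F, of "z + 1" w] by simp
  have ne: "wrap n (z + 1) \<noteq> wrap n z"
    using wrap_eq_window[OF n, of "z + 1" z] zw by auto
  have eq: "wrap n (int (wrap n z) + 1) = wrap n (z + 1)"
    using wrap_decomp[OF n, of z] wrap_add_mult[of n "int (wrap n z) + 1" "(z - 1) div int n"]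
    by (simp add: algebra_simps)
  show thesis
    using that[of "wrap n z"] wrap_in[OF n, of z] ne eq Fw[of z] Fw[of "z + 1"] Fz by simp
qed

section \<open>Classification of the endomorphisms\<close>

lemma wrap_wrap [simp]: "n > 0 \<Longrightarrow> wrap n (int (wrap n z)) = wrap n z"
  using wrap_of_nat[OF wrap_in] .

lemma wrap_affine_cong:
  assumes "n > 0" "wrap n z = wrap n w"
  shows "wrap n (a + s * z) = wrap n (a + s * w)"
proof -
  obtain q where "w = z + q * int n"
    using wrap_eqE assms by blast
  then have "a + s * w = a + s * z + (s * q) * int n"
    by (simp add: algebra_simps)
  then show ?thesis
    by (simp only: wrap_add_mult)
qed

lemma wrap_affine_wrap: "n > 0 \<Longrightarrow> wrap n (a + s * int (wrap n z)) = wrap n (a + s * z)"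
  by (rule wrap_affine_cong) simp_all

text \<open>Following \<open>\<alpha>\<close> by the rotation that brings the image of
  \<open>1\<close> back to \<open>1\<close> leaves an injective map with a fixed point, which
  \<open>OP_perm_fixing_point\<close> identifies as the identity.\<close>

lemma OP_inj_is_rot:
  assumes n: "n > 0" and \<alpha>: "\<alpha> \<in> carrier (OP n)" and inj: "inj_on \<alpha> {1..n}"
  obtains j where "\<alpha> = rot n j"
proof
  interpret monoid "OP n"
    using monoid_OP[OF n] .
  let ?j = "int (\<alpha> 1) - 1"
  let ?\<beta> = "\<alpha> \<otimes>\<^bsub>OP n\<^esub> rot n (- ?j)"
  have \<beta>: "?\<beta> \<in> carrier (OP n)"
    using \<alpha> rot_in_OP[OF n] by simp
  have ap: "?\<beta> x = wrap n (int (\<alpha> x) - ?j)" if "x \<in> {1..n}" for x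
    using that OP_mem[OF \<alpha> that] by (simp add: rot_def algebra_simps)
  have "?\<beta> x = x" if x: "x \<in> {1..n}" for x
  proof (rule OP_perm_fixing_point[OF n \<beta> subset_refl])
    show "?\<beta> ` {1..n} \<subseteq> {1..n}"
      using OP_mem[OF \<beta>] by blast
    show "inj_on ?\<beta> {1..n}"
    proof (rule inj_onI)
      fix x y assume xy: "x \<in> {1..n}" "y \<in> {1..n}" "?\<beta> x = ?\<beta> y"
      then have "wrap n (int (\<alpha> x) - ?j) = wrap n (int (\<alpha> y) - ?j)"
        using ap by simp
      then have "int (\<alpha> x) - ?j = int (\<alpha> y) - ?j"
        by (rule wrap_eq_window[OF n]) (use OP_mem[OF \<alpha> xy(1)] OP_mem[OF \<alpha> xy(2)] in auto)
      then show "x = y"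
        using inj xy by (auto dest: inj_onD)
    qed
    show "?\<beta> 1 = 1"
      using ap[of 1] wrap_of_nat[of 1 n] n by simp
  qed (use x n in auto)
  then have "?\<beta> = \<one>\<^bsub>OP n\<^esub>"
    by (intro OP_ext[OF \<beta> one_closed]) simp
  then have "\<alpha> \<otimes>\<^bsub>OP n\<^esub> (rot n (- ?j) \<otimes>\<^bsub>OP n\<^esub> rot n ?j) = rot n ?j"
    using m_assoc[OF \<alpha> rot_in_OP[OF n] rot_in_OP[OF n], of "- ?j" ?j] rot_in_OP[OF n] by simp
  then show "\<alpha> = rot n ?j"
    using rot_mult[OF n, of "- ?j" ?j] rot_0 \<alpha> by simp
qed

text \<open>On a finite set an injective \<open>\<alpha>\<close> is onto, so injectivity of
  \<open>\<beta>\<close> on its image is injectivity everywhere. The non-injective maps thus form an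
  ideal with multiplicatively closed complement, as \<open>collapse_endo\<close> requires.\<close>

lemma OP_mult_inj_iff:
  assumes "n > 0" "\<alpha> \<in> carrier (OP n)" "\<beta> \<in> carrier (OP n)"
  shows "inj_on (\<alpha> \<otimes>\<^bsub>OP n\<^esub> \<beta>) {1..n} \<longleftrightarrow> inj_on \<alpha> {1..n} \<and> inj_on \<beta> {1..n}"
proof -
  have "inj_on (\<alpha> \<otimes>\<^bsub>OP n\<^esub> \<beta>) {1..n} \<longleftrightarrow> inj_on (\<beta> \<circ> \<alpha>) {1..n}"
    by (rule inj_on_cong) simp
  also have "\<dots> \<longleftrightarrow> inj_on \<alpha> {1..n} \<and> inj_on \<beta> (\<alpha> ` {1..n})"
    using comp_inj_on inj_on_imageI inj_on_imageI2 by (metis comp_inj_on_iff inj_on_imageI2)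
  also have "\<dots> \<longleftrightarrow> inj_on \<alpha> {1..n} \<and> inj_on \<beta> {1..n}"
    using endo_inj_surj[of "{1..n}" \<alpha>] OP_mem[OF assms(2)]
    by (metis finite_atLeastAtMost image_subsetI)
  finally show ?thesis .
qed

section \<open>The two families of endomorphisms\<close>

definition conj_endo :: "nat \<Rightarrow> nat \<Rightarrow> int \<Rightarrow> (nat \<Rightarrow> nat) \<Rightarrow> nat \<Rightarrow> nat" where
  "conj_endo n c s = (\<lambda>\<alpha>\<in>carrier (OP n). \<lambda>y\<in>{1..n}.
     wrap n (int c + s * int (\<alpha> (wrap n (- (s * int c) + s * int y)))))"

definition collapse_endo :: "nat \<Rightarrow> (nat \<Rightarrow> nat) \<Rightarrow> (nat \<Rightarrow> nat) \<Rightarrow> (nat \<Rightarrow> nat) \<Rightarrow> nat \<Rightarrow> nat" where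
  "collapse_endo n e f = (\<lambda>\<alpha>\<in>carrier (OP n). if inj_on \<alpha> {1..n} then e else f)"

definition idems :: "nat \<Rightarrow> (nat \<Rightarrow> nat) set" where
  "idems n = {e \<in> carrier (OP n). e \<otimes>\<^bsub>OP n\<^esub> e = e}"

text \<open>The condition on \<open>f\<close> is \<open>f \<le> e\<close> in the natural partial
  order of idempotents.\<close>

definition idem_pairs :: "nat \<Rightarrow> ((nat \<Rightarrow> nat) \<times> (nat \<Rightarrow> nat)) set" where
  "idem_pairs n = (SIGMA e:idems n. {f \<in> idems n. e \<otimes>\<^bsub>OP n\<^esub> f = f \<and> f \<otimes>\<^bsub>OP n\<^esub> e = f})"

text \<open>Since \<open>s * s = 1\<close>, the dihedral map \<open>c + s x\<close> is undone by
  \<open>- s c + s y\<close>; this is the inner expression in \<open>conj_endo\<close>.\<close>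

lemma dihedral_inverse:
  assumes "n > 0" "s \<in> {1, -1 :: int}" "x \<in> {1..n}"
  shows "wrap n (- (s * c) + s * int (wrap n (c + s * int x))) = x"
    and "wrap n (c + s * int (wrap n (- (s * c) + s * int x))) = x"
proof -
  have "- (s * c) + s * (c + s * int x) = int x" "c + s * (- (s * c) + s * int x) = int x"
    using assms(2) by auto
  then show "wrap n (- (s * c) + s * int (wrap n (c + s * int x))) = x"
    and "wrap n (c + s * int (wrap n (- (s * c) + s * int x))) = x"
    using assms by (simp_all only: wrap_affine_wrap wrap_of_nat)
qed

lemma conj_endo_hom:
  assumes n: "n > 0" and s: "s \<in> {1, -1}"
  shows "conj_endo n c s \<in> semigroup_endos (OP n)"
proof -
  interpret monoid "OP n"
    using monoid_OP[OF n] .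
  let ?d = "\<lambda>x. wrap n (int c + s * int x)" and ?d' = "\<lambda>y. wrap n (- (s * int c) + s * int y)"
  have val: "conj_endo n c s \<alpha> = restrict (\<lambda>y. ?d (\<alpha> (?d' y))) {1..n}" if "\<alpha> \<in> carrier (OP n)" for \<alpha>
    using that by (simp add: conj_endo_def)
  have closed: "conj_endo n c s \<alpha> \<in> carrier (OP n)" if \<alpha>: "\<alpha> \<in> carrier (OP n)" for \<alpha>
  proof -
    obtain F where F: "is_lift n n F \<alpha>"
      using carrier_OP_iff[OF n] \<alpha> by blast
    \<comment> \<open>A reflection (\<open>s = -1\<close>) reverses the order once before and once
      after \<open>F\<close>, so \<open>G\<close> is monotone in both cases.\<close>
    define G where "G z = int c + s * F (- (s * int c) + s * z)" for z
    have "is_lift n n G (\<lambda>y. ?d (\<alpha> (?d' y)))"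
      unfolding is_lift_def
    proof (intro conjI allI ballI)
      show "mono G"
        using s is_liftD(1)[OF F] by (auto simp: G_def mono_def)
      show "G (z + int n) = G z + int n" for z
        using s is_lift_add_mult[OF F, of "- (s * int c) + s * z" s]
        by (auto simp: G_def algebra_simps)
      show "?d (\<alpha> (?d' y)) = wrap n (G (int y))" for y
        unfolding G_def is_lift_wrap[OF F n] using n by (rule wrap_affine_wrap)
    qed
    then show ?thesis
      using val[OF \<alpha>] restrict_in_OP[OF n] by simp
  qed
  have mult: "conj_endo n c s (\<alpha> \<otimes>\<^bsub>OP n\<^esub> \<beta>) = conj_endo n c s \<alpha> \<otimes>\<^bsub>OP n\<^esub> conj_endo n c s \<beta>"
    if \<alpha>: "\<alpha> \<in> carrier (OP n)" and \<beta>: "\<beta> \<in> carrier (OP n)" for \<alpha> \<beta>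
  proof (rule OP_ext)
    fix x assume x: "x \<in> {1..n}"
    have 1: "?d' x \<in> {1..n}" and 2: "?d (\<alpha> (?d' x)) \<in> {1..n}"
      using n by (simp_all only: wrap_in)
    have "conj_endo n c s (\<alpha> \<otimes>\<^bsub>OP n\<^esub> \<beta>) x = ?d (\<beta> (\<alpha> (?d' x)))"
      using x 1 by (simp only: val[OF m_closed[OF \<alpha> \<beta>]] restrict_apply if_True OP_mult_apply)
    also have "\<dots> = ?d (\<beta> (?d' (?d (\<alpha> (?d' x)))))"
      using dihedral_inverse(1)[OF n s OP_mem[OF \<alpha> 1], of "int c"] by simp
    also have "\<dots> = (conj_endo n c s \<alpha> \<otimes>\<^bsub>OP n\<^esub> conj_endo n c s \<beta>) x"
      using x 2 by (simp only: val[OF \<alpha>] val[OF \<beta>] restrict_apply if_True OP_mult_apply)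
    finally show "conj_endo n c s (\<alpha> \<otimes>\<^bsub>OP n\<^esub> \<beta>) x = (conj_endo n c s \<alpha> \<otimes>\<^bsub>OP n\<^esub> conj_endo n c s \<beta>) x" .
  qed (use that closed in auto)
  show ?thesis
    using closed mult by (auto simp: semigroup_endos_def hom_def conj_endo_def)
qed

lemma collapse_endo_hom:
  assumes n: "n > 0" and ef: "(e, f) \<in> idem_pairs n"
  shows "collapse_endo n e f \<in> semigroup_endos (OP n)"
proof -
  interpret monoid "OP n"
    using monoid_OP[OF n] .
  have "collapse_endo n e f (\<alpha> \<otimes>\<^bsub>OP n\<^esub> \<beta>) = collapse_endo n e f \<alpha> \<otimes>\<^bsub>OP n\<^esub> collapse_endo n e f \<beta>"
    if "\<alpha> \<in> carrier (OP n)" "\<beta> \<in> carrier (OP n)" for \<alpha> \<beta>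
    using that ef OP_mult_inj_iff[OF n that]
    by (simp add: collapse_endo_def idem_pairs_def idems_def)
  then show ?thesis
    using ef by (auto simp: semigroup_endos_def hom_def collapse_endo_def idem_pairs_def idems_def)
qed

section \<open>Structure of an arbitrary endomorphism\<close>

context
  fixes n :: nat and \<phi> :: "(nat \<Rightarrow> nat) \<Rightarrow> nat \<Rightarrow> nat"
  assumes n3: "n \<ge> 3" and endo: "\<phi> \<in> hom (OP n) (OP n)"
begin

lemma n_pos: "n > 0"
  using n3 by simp

interpretation monoid "OP n"
  using monoid_OP[OF n_pos] .

lemma endo_closed: "\<alpha> \<in> carrier (OP n) \<Longrightarrow> \<phi> \<alpha> \<in> carrier (OP n)"
  using endo by (auto simp: hom_def)

lemma endo_mem: "\<alpha> \<in> carrier (OP n) \<Longrightarrow> x \<in> {1..n} \<Longrightarrow> \<phi> \<alpha> x \<in> {1..n}"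
  using OP_mem endo_closed by blast

lemma endo_mult:
  "\<alpha> \<in> carrier (OP n) \<Longrightarrow> \<beta> \<in> carrier (OP n) \<Longrightarrow> \<phi> (\<alpha> \<otimes>\<^bsub>OP n\<^esub> \<beta>) = \<phi> \<alpha> \<otimes>\<^bsub>OP n\<^esub> \<phi> \<beta>"
  using endo by (auto simp: hom_def)

lemma endo_mult_apply:
  "\<alpha> \<in> carrier (OP n) \<Longrightarrow> \<beta> \<in> carrier (OP n) \<Longrightarrow> x \<in> {1..n} \<Longrightarrow>
    \<phi> \<beta> (\<phi> \<alpha> x) = \<phi> (\<alpha> \<otimes>\<^bsub>OP n\<^esub> \<beta>) x"
  by (simp add: endo_mult)

text \<open>Equivariance, from \<open>const_map_mult\<close>: for fixed \<open>x\<close>, sending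
  \<open>y\<close> to \<open>\<phi> (const_map n y) x\<close> intertwines \<open>\<alpha>\<close>
  with \<open>\<phi> \<alpha>\<close>.\<close>

lemma endo_const_apply:
  "\<alpha> \<in> carrier (OP n) \<Longrightarrow> y \<in> {1..n} \<Longrightarrow> x \<in> {1..n} \<Longrightarrow>
    \<phi> \<alpha> (\<phi> (const_map n y) x) = \<phi> (const_map n (\<alpha> y)) x"
  using endo_mult_apply[OF const_map_in_OP] const_map_mult(1)[OF n_pos] by simp

lemma endo_rot_apply:
  "x \<in> {1..n} \<Longrightarrow> \<phi> (rot n j) (\<phi> (rot n i) x) = \<phi> (rot n (i + j)) x"
  using endo_mult_apply[OF rot_in_OP rot_in_OP] rot_mult n_pos by simp

text \<open>The image of a rotation permutes the fixed points of the idempotent image of the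
  identity. Fixing one of them, it fixes all; these points are the whole range of that idempotent,
  and applying the idempotent first changes nothing, so the two maps agree.\<close>

lemma endo_rot_fixing_point:
  assumes y: "y \<in> {1..n}" "\<phi> \<one>\<^bsub>OP n\<^esub> y = y" "\<phi> (rot n j) y = y"
  shows "\<phi> (rot n j) = \<phi> \<one>\<^bsub>OP n\<^esub>"
proof -
  let ?e = "\<phi> \<one>\<^bsub>OP n\<^esub>" and ?h = "\<phi> (rot n j)"
  note r = rot_in_OP[OF n_pos]
  define P where "P = {x \<in> {1..n}. ?e x = x}"
  have idem: "?e (?e x) = ?e x" if "x \<in> {1..n}" for x
    using endo_mult_apply[OF one_closed one_closed that] by simp
  have eh: "?e (?h x) = ?h x" if "x \<in> {1..n}" for x
    using endo_mult_apply[OF r one_closed that] r by simp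
  have he: "?h (?e x) = ?h x" if "x \<in> {1..n}" for x
    using endo_mult_apply[OF one_closed r that] r by simp
  have "?h x = x" if "x \<in> P" for x
  proof (rule OP_perm_fixing_point[OF n_pos endo_closed[OF r], of P j y])
    show "P \<subseteq> {1..n}"
      by (auto simp: P_def)
    show "?h ` P \<subseteq> P"
      using eh endo_mem[OF r] unfolding P_def by blast
    show "inj_on ?h P"
    proof (rule inj_onI)
      fix x x' assume *: "x \<in> P" "x' \<in> P" "?h x = ?h x'"
      then have "\<phi> (rot n (j + -j)) x = \<phi> (rot n (j + -j)) x'"
        using endo_rot_apply[of x "-j" j] endo_rot_apply[of x' "-j" j] by (simp add: P_def)
      then show "x = x'"
        using * by (simp add: P_def rot_0)
    qed
  qed (use that y in \<open>auto simp: P_def\<close>)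
  moreover have "?e x \<in> P" if "x \<in> {1..n}" for x
    using idem[OF that] endo_mem[OF one_closed that] by (simp add: P_def)
  ultimately have "?h x = ?e x" if "x \<in> {1..n}" for x
    using he[OF that] that by metis
  then show ?thesis
    by (intro OP_ext[OF endo_closed[OF r] endo_closed[OF one_closed]])
qed

text \<open>If the image of a rotation fixes the value \<open>y\<close> at \<open>1\<close>, the
  rotation fixes \<open>x\<close>, because injectivity on constants separates \<open>x\<close> from
  its rotations. So the orbit of \<open>y\<close> under the images of the rotations has
  \<open>n\<close> points and is everything.\<close>

lemma endo_const_is_const:
  assumes inj: "inj_on (\<lambda>x. \<phi> (const_map n x)) {1..n}" and x: "x \<in> {1..n}" and z: "z \<in> {1..n}"
  shows "\<phi> (const_map n x) z = \<phi> (const_map n x) 1"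
proof -
  note r = rot_in_OP[OF n_pos] and cx = const_map_in_OP[OF x]
  have one: "1 \<in> {1..n}"
    using n_pos by simp
  define y where "y = \<phi> (const_map n x) 1"
  have y: "y \<in> {1..n}"
    unfolding y_def using endo_mem[OF cx one] .
  have ey: "\<phi> \<one>\<^bsub>OP n\<^esub> (\<phi> (const_map n x) w) = \<phi> (const_map n x) w" if "w \<in> {1..n}" for w
    using endo_const_apply[OF one_closed x that] x by simp
  have uy: "\<phi> (const_map n x) y = y"
    unfolding y_def using endo_const_apply[OF cx x one] x by (simp add: const_map_def)
  have rotx: "rot n j x = wrap n (int x + j)" for j
    using x by (simp add: rot_def)
  have free: "wrap n (int x + j) = x" if "\<phi> (rot n j) y = y" for j
  proof -
    have "\<phi> (rot n j) = \<phi> \<one>\<^bsub>OP n\<^esub>"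
      using endo_rot_fixing_point[OF y _ that] ey[OF one] by (simp add: y_def)
    then have "\<phi> (const_map n x \<otimes>\<^bsub>OP n\<^esub> rot n j) = \<phi> (const_map n x \<otimes>\<^bsub>OP n\<^esub> \<one>\<^bsub>OP n\<^esub>)"
      using endo_mult[OF cx r] endo_mult[OF cx one_closed] by simp
    then have "\<phi> (const_map n (wrap n (int x + j))) = \<phi> (const_map n x)"
      using const_map_mult(1)[OF n_pos r x] cx rotx by simp
    then show ?thesis
      using inj_onD[OF inj] x wrap_in[OF n_pos] by blast
  qed
  have "inj_on (\<lambda>j. \<phi> (rot n j) y) {0..<int n}"
  proof (rule inj_onI)
    fix i j assume ij: "i \<in> {0..<int n}" "j \<in> {0..<int n}" "\<phi> (rot n i) y = \<phi> (rot n j) y"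
    have "\<phi> (rot n (j + - i)) y = \<phi> (rot n (i + - i)) y"
      using endo_rot_apply[OF y, of "- i"] ij(3) by metis
    then have "\<phi> (rot n (j + - i)) y = y"
      using ey[OF one] by (simp add: rot_0 y_def)
    then have "wrap n (int x + (j + - i)) = wrap n (int x)"
      using free x by simp
    then have "int x + (j + - i) = int x"
      by (rule wrap_eq_window[OF n_pos]) (use ij in auto)
    then show "i = j"
      by simp
  qed
  then have "card ((\<lambda>j. \<phi> (rot n j) y) ` {0..<int n}) = card {1..n}"
    by (simp add: card_image)
  moreover have "(\<lambda>j. \<phi> (rot n j) y) ` {0..<int n} \<subseteq> {1..n}"
    using endo_mem[OF r y] by blast
  ultimately have "(\<lambda>j. \<phi> (rot n j) y) ` {0..<int n} = {1..n}"
    by (intro card_subset_eq) auto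
  then have "z \<in> (\<lambda>j. \<phi> (rot n j) y) ` {0..<int n}"
    using z by simp
  then obtain j where j: "z = \<phi> (rot n j) y"
    by blast
  define x' where "x' = rot n j x"
  have x': "x' \<in> {1..n}"
    unfolding x'_def using OP_mem[OF r x] .
  have move: "\<phi> (rot n j) (\<phi> (const_map n x) w) = \<phi> (const_map n x') w" if "w \<in> {1..n}" for w
    unfolding x'_def using endo_const_apply[OF r x that] .
  \<comment> \<open>Rotating \<open>x\<close> to \<open>x'\<close> makes \<open>z\<close> a fixed
    point of the image of the constant \<open>x'\<close>; undoing the rotation carries this back to
    \<open>x\<close> and \<open>y\<close>.\<close>
  have "\<phi> (const_map n x') (\<phi> (const_map n x') y) = \<phi> (const_map n x') y"
    using endo_const_apply[OF const_map_in_OP[OF x'] x' y] x' by (simp add: const_map_def)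
  then have "\<phi> (const_map n x') z = z"
    using move[OF y] uy j by simp
  then have "\<phi> (rot n j) (\<phi> (const_map n x) z) = \<phi> (rot n j) y"
    using move[OF z] j by simp
  then have "\<phi> (rot n (j + - j)) (\<phi> (const_map n x) z) = \<phi> (rot n (j + - j)) y"
    using endo_rot_apply[OF endo_mem[OF cx z], of "- j" j] endo_rot_apply[OF y, of "- j" j] by simp
  then show ?thesis
    using ey[OF z] ey[OF one] by (simp add: rot_0 y_def)
qed

text \<open>Images of constants being constants, they define a bijection \<open>\<theta>\<close>
  with \<open>\<phi> \<alpha> (\<theta> x) = \<theta> (\<alpha> x)\<close>. So \<open>\<phi>\<close>
  is conjugation by \<open>\<theta>\<close>, and only the shape of \<open>\<theta>\<close> remains
  to be found.\<close>

lemma endo_inj_on_consts: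
  assumes inj: "inj_on (\<lambda>x. \<phi> (const_map n x)) {1..n}"
  obtains c s where "c \<in> {1..n}" "s \<in> {1, -1}"
    "\<And>\<alpha>. \<alpha> \<in> carrier (OP n) \<Longrightarrow> \<phi> \<alpha> = conj_endo n c s \<alpha>"
proof -
  define \<theta> where "\<theta> x = \<phi> (const_map n x) 1" for x
  have one: "1 \<in> {1..n}"
    using n_pos by simp
  have \<theta>_mem: "\<theta> x \<in> {1..n}" if "x \<in> {1..n}" for x
    unfolding \<theta>_def using endo_mem[OF const_map_in_OP[OF that] one] .
  have equi: "\<phi> \<alpha> (\<theta> x) = \<theta> (\<alpha> x)" if "\<alpha> \<in> carrier (OP n)" "x \<in> {1..n}" for \<alpha> x
    unfolding \<theta>_def using endo_const_apply[OF that one] .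
  have \<theta>_inj: "inj_on \<theta> {1..n}"
  proof (rule inj_onI)
    fix x x' assume *: "x \<in> {1..n}" "x' \<in> {1..n}" "\<theta> x = \<theta> x'"
    have "\<phi> (const_map n x) z = \<phi> (const_map n x') z" if "z \<in> {1..n}" for z
      using endo_const_is_const[OF inj *(1) that] endo_const_is_const[OF inj *(2) that] *(3)
      unfolding \<theta>_def by argo
    then have "\<phi> (const_map n x) = \<phi> (const_map n x')"
      using * by (intro OP_ext[OF endo_closed endo_closed] const_map_in_OP)
    then show "x = x'"
      using inj_onD[OF inj] * by blast
  qed
  have \<theta>_surj: "\<theta> ` {1..n} = {1..n}"
    using \<theta>_mem \<theta>_inj by (intro endo_inj_surj) auto
  \<comment> \<open>The image of \<open>push n a\<close> fixes every point except possibly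
    \<open>\<theta> a\<close>, which by \<open>OP_moving_one_point\<close> stays or goes to a
    neighbour; injectivity of \<open>\<theta>\<close> rules out staying.\<close>
  have adj: "\<exists>s\<in>{1, -1}. \<theta> (wrap n (z + 1)) = wrap n (int (\<theta> (wrap n z)) + s)" for z
  proof -
    define a where "a = wrap n z"
    have a: "a \<in> {1..n}"
      using wrap_in[OF n_pos] by (simp only: a_def)
    have a1: "wrap n (int a + 1) = wrap n (z + 1)"
      using wrap_affine_wrap[OF n_pos, of 1 1 z] by (simp add: a_def add.commute)
    note p = push_in_OP[OF n_pos, of a]
    have "\<phi> (push n a) (wrap n (int (\<theta> a))) \<in>
      {wrap n (int (\<theta> a) - 1), wrap n (int (\<theta> a)), wrap n (int (\<theta> a) + 1)}"
    proof (rule OP_moving_one_point[OF n_pos endo_closed[OF p] _ n3])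
      fix y assume y: "y \<in> {1..n}" "y \<noteq> wrap n (int (\<theta> a))"
      obtain x where x: "x \<in> {1..n}" "y = \<theta> x"
        using y \<theta>_surj by (metis imageE)
      then have "x \<noteq> a"
        using y \<theta>_mem[OF a] by auto
      then show "\<phi> (push n a) y = y"
        using equi[OF p x(1)] x by (simp add: push_def)
    qed
    moreover have "\<phi> (push n a) (wrap n (int (\<theta> a))) = \<theta> (wrap n (z + 1))"
      using equi[OF p a] \<theta>_mem[OF a] a a1 by (simp add: push_def)
    moreover have "\<theta> (wrap n (z + 1)) \<noteq> wrap n (int (\<theta> a))"
    proof
      assume "\<theta> (wrap n (z + 1)) = wrap n (int (\<theta> a))"
      then have "\<theta> (wrap n (z + 1)) = \<theta> (wrap n z)"
        using \<theta>_mem[OF a] by (simp add: a_def)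
      then have "wrap n (z + 1) = wrap n z"
        using inj_onD[OF \<theta>_inj] wrap_in[OF n_pos] by blast
      then show False
        using wrap_eq_window[OF n_pos, of "z + 1" z] n3 by simp
    qed
    ultimately show ?thesis
      by (auto simp: a_def)
  qed
  obtain s where s: "s \<in> {1, -1}" and s1: "\<theta> (wrap n (1 + 1)) = wrap n (int (\<theta> (wrap n 1)) + s)"
    using adj by blast
  have w1: "wrap n 1 = 1"
    using wrap_of_nat[OF one] by simp
  \<comment> \<open>Two consecutive values are carried so that a change of direction is visible: it
    would return to the value two steps back, which \<open>n \<ge> 3\<close> and injectivity
    forbid.\<close>
  have arith: "\<theta> (wrap n (1 + int j)) = wrap n (int (\<theta> 1) + s * int j) \<and>
      \<theta> (wrap n (2 + int j)) = wrap n (int (\<theta> 1) + s * (int j + 1))" for j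
  proof (induction j)
    case 0
    then show ?case
      using s1 w1 \<theta>_mem[OF one] by simp
  next
    case (Suc j)
    obtain s' where s': "s' \<in> {1, -1}" and
      "\<theta> (wrap n (2 + int j + 1)) = wrap n (int (\<theta> (wrap n (2 + int j))) + s')"
      using adj by blast
    then have next_val: "\<theta> (wrap n (3 + int j)) = wrap n (int (\<theta> 1) + s * (int j + 1) + s')"
      using Suc.IH wrap_affine_wrap[OF n_pos, of s' 1 "int (\<theta> 1) + s * (int j + 1)"]
      by (simp add: algebra_simps)
    have "s' = s"
    proof (rule ccontr)
      assume "s' \<noteq> s"
      then have "s' = - s"
        using s s' by auto
      then have "\<theta> (wrap n (3 + int j)) = \<theta> (wrap n (1 + int j))"
        using next_val Suc.IH by (simp add: algebra_simps)
      then have "wrap n (3 + int j) = wrap n (1 + int j)"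
        using inj_onD[OF \<theta>_inj] wrap_in[OF n_pos] by blast
      then have "3 + int j = 1 + int j"
        by (rule wrap_eq_window[OF n_pos]) (use n3 in auto)
      then show False
        by simp
    qed
    then show ?case
      using Suc.IH next_val by (simp add: algebra_simps)
  qed
  \<comment> \<open>The extrapolated value of \<open>\<theta>\<close> at \<open>0\<close>, so that
    \<open>\<theta> x\<close> is \<open>c + s x\<close> modulo \<open>n\<close>.\<close>
  define c where "c = wrap n (int (\<theta> 1) - s)"
  have \<theta>_eq: "\<theta> x = wrap n (int c + s * int x)" if x: "x \<in> {1..n}" for x
  proof -
    have "\<theta> x = wrap n (int (\<theta> 1) + s * int (x - 1))"
      using arith[of "x - 1"] x by simp
    also have "\<dots> = wrap n (s * int x + 1 * (int (\<theta> 1) - s))"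
      using x by (simp add: algebra_simps of_nat_diff)
    also have "\<dots> = wrap n (s * int x + 1 * int c)"
      unfolding c_def by (rule wrap_affine_wrap[OF n_pos, symmetric])
    finally show ?thesis
      by (simp add: add.commute)
  qed
  show thesis
  proof
    show "c \<in> {1..n}"
      unfolding c_def using wrap_in[OF n_pos] .
    show "s \<in> {1, -1}" by fact
    fix \<alpha> assume \<alpha>: "\<alpha> \<in> carrier (OP n)"
    have conj: "conj_endo n c s \<alpha> \<in> carrier (OP n)"
      using conj_endo_hom[OF n_pos s, of c] \<alpha> by (auto simp: semigroup_endos_def hom_def)
    show "\<phi> \<alpha> = conj_endo n c s \<alpha>"
    proof (rule OP_ext[OF endo_closed[OF \<alpha>] conj])
      fix y assume y: "y \<in> {1..n}"
      then obtain x where x: "x \<in> {1..n}" "y = \<theta> x"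
        using \<theta>_surj by (metis imageE)
      have "wrap n (- (s * int c) + s * int y) = x"
        using dihedral_inverse(1)[OF n_pos s x(1), of "int c"] \<theta>_eq[OF x(1)] x(2) by simp
      then have "conj_endo n c s \<alpha> y = wrap n (int c + s * int (\<alpha> x))"
        using \<alpha> y by (simp add: conj_endo_def)
      then show "\<phi> \<alpha> y = conj_endo n c s \<alpha> y"
        using \<theta>_eq[OF OP_mem[OF \<alpha> x(1)]] equi[OF \<alpha> x(1)] x(2) by simp
    qed
  qed
qed

lemma endo_not_inj_on_consts:
  assumes ninj: "\<not> inj_on (\<lambda>x. \<phi> (const_map n x)) {1..n}"
  obtains e f where "(e, f) \<in> idem_pairs n"
    "\<And>\<alpha>. \<alpha> \<in> carrier (OP n) \<Longrightarrow> \<phi> \<alpha> = collapse_endo n e f \<alpha>"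
proof -
  note r = rot_in_OP[OF n_pos] and p = push_in_OP[OF n_pos]
  have one: "1 \<in> {1..n}"
    using n_pos by simp
  note c1 = const_map_in_OP[OF one]
  define e where "e = \<phi> \<one>\<^bsub>OP n\<^esub>"
  define f where "f = \<phi> (const_map n 1)"
  obtain x y where xy: "x \<in> {1..n}" "y \<in> {1..n}" "x < y" "\<phi> (const_map n x) = \<phi> (const_map n y)"
    using ninj by (metis (no_types, lifting) inj_onI linorder_neqE_nat)
  have const: "\<phi> (const_map n q) = f" if q: "q \<in> {1..n}" for q
  proof -
    \<comment> \<open>A two-valued map sending \<open>x\<close> to \<open>1\<close> and
      \<open>y\<close> to \<open>q\<close>; it carries the single coincidence over to the constants
      \<open>1\<close> and \<open>q\<close>.\<close>
    let ?\<alpha> = "\<lambda>z\<in>{1..n}. if z < y then 1 else q"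
    have \<alpha>: "?\<alpha> \<in> carrier (OP n)"
      by (rule mono_restrict_in_OP[OF n_pos]) (use q n_pos in \<open>auto intro!: mono_onI\<close>)
    have "\<phi> (const_map n x \<otimes>\<^bsub>OP n\<^esub> ?\<alpha>) = \<phi> (const_map n y \<otimes>\<^bsub>OP n\<^esub> ?\<alpha>)"
      using endo_mult[OF const_map_in_OP \<alpha>] xy by simp
    then show ?thesis
      using const_map_mult(1)[OF n_pos \<alpha>] xy by (simp add: f_def)
  qed
  have f_mult: "f \<otimes>\<^bsub>OP n\<^esub> \<phi> \<alpha> = f" if "\<alpha> \<in> carrier (OP n)" for \<alpha>
    using endo_mult[OF c1 that] const_map_mult(1)[OF n_pos that one] const[OF OP_mem[OF that one]]
    by (simp add: f_def)
  have mult_f: "\<phi> \<alpha> \<otimes>\<^bsub>OP n\<^esub> f = f" if "\<alpha> \<in> carrier (OP n)" for \<alpha>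
    using endo_mult[OF that c1] const_map_mult(2)[OF n_pos that one] by (simp add: f_def)
  have fixed: "\<phi> \<alpha> (f 1) = f 1" if "\<alpha> \<in> carrier (OP n)" for \<alpha>
    using f_mult[OF that] one by (metis OP_mult_apply)
  have f1: "f 1 \<in> {1..n}"
    unfolding f_def using endo_mem[OF c1 one] .
  \<comment> \<open>\<open>f 1\<close> is fixed by every member of the image, so
    \<open>endo_rot_fixing_point\<close> applies to all rotations at once.\<close>
  have rot_e: "\<phi> (rot n j) = e" for j
    unfolding e_def using endo_rot_fixing_point[OF f1] fixed r by simp
  define w where "w = \<phi> (push n 1)"
  have push_w: "\<phi> (push n a) = w" if a: "a \<in> {1..n}" for a
  proof -
    \<comment> \<open>Rotate \<open>a\<close> to \<open>1\<close>, push, rotate back. As rotations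
      go to \<open>e\<close>, the image of the identity, all pushes get the same image
      \<open>w\<close>.\<close>
    have "push n a = rot n (1 - int a) \<otimes>\<^bsub>OP n\<^esub> (push n 1 \<otimes>\<^bsub>OP n\<^esub> rot n (int a - 1))"
    proof (rule OP_ext)
      fix x assume x: "x \<in> {1..n}"
      let ?x' = "wrap n (int x + (1 - int a))"
      have x': "?x' \<in> {1..n}"
        using wrap_in[OF n_pos] .
      have return: "wrap n (int (wrap n z) + (int a - 1)) = wrap n (z + (int a - 1))" for z
        using wrap_affine_wrap[OF n_pos, of "int a - 1" 1 z] by (simp add: algebra_simps)
      have return': "wrap n (int (wrap n 2) + (int a - 1)) = wrap n (int a + 1)"
        "wrap n (int ?x' + (int a - 1)) = x"
        unfolding return using x by (simp_all add: add.commute)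
      have "?x' = 1 \<longleftrightarrow> x = a"
      proof
        assume "?x' = 1"
        then have "wrap n (int x + (1 - int a)) = wrap n 1"
          using wrap_of_nat[OF one] by simp
        then have "int x + (1 - int a) = 1"
          by (rule wrap_eq_window[OF n_pos]) (use x a in auto)
        then show "x = a"
          by simp
      qed (use wrap_of_nat[OF one] in simp)
      moreover have "(rot n (1 - int a) \<otimes>\<^bsub>OP n\<^esub> (push n 1 \<otimes>\<^bsub>OP n\<^esub> rot n (int a - 1))) x =
        wrap n (int (if ?x' = 1 then wrap n 2 else ?x') + (int a - 1))"
        using x x' wrap_in[OF n_pos, of 2] by (simp add: rot_def push_def del: wrap_in)
      ultimately show "push n a x = (rot n (1 - int a) \<otimes>\<^bsub>OP n\<^esub> (push n 1 \<otimes>\<^bsub>OP n\<^esub> rot n (int a - 1))) x"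
        using x return' by (auto simp: push_def)
    qed (use r p in auto)
    then have "\<phi> (push n a) = \<phi> \<one>\<^bsub>OP n\<^esub> \<otimes>\<^bsub>OP n\<^esub> (\<phi> (push n 1) \<otimes>\<^bsub>OP n\<^esub> \<phi> \<one>\<^bsub>OP n\<^esub>)"
      using endo_mult r p rot_e by (simp add: e_def)
    also have "\<dots> = \<phi> (push n 1)"
      using endo_mult[symmetric] p by simp
    finally show ?thesis
      by (simp add: w_def)
  qed
  have w_idem: "w \<otimes>\<^bsub>OP n\<^esub> w = w"
  proof -
    have "wrap n 2 = 2"
      using wrap_of_nat[of 2 n] n3 by simp
    then have "push n 1 \<otimes>\<^bsub>OP n\<^esub> push n 1 = push n 1"
      using p n3 by (intro OP_ext) (auto simp: push_def)
    then show ?thesis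
      unfolding w_def using endo_mult[OF p p] by metis
  qed
  \<comment> \<open>The product of the pushes at \<open>1\<close>, ..., \<open>k + 1\<close> sweeps
    the initial segment onto \<open>k + 2\<close>. Every factor has image \<open>w\<close> and
    \<open>w\<close> is idempotent, so the product has image \<open>w\<close>; at
    \<open>k = n - 2\<close> it is a constant.\<close>
  have "\<exists>\<gamma>\<in>carrier (OP n). \<phi> \<gamma> = w \<and> (\<forall>x\<in>{1..n}. \<gamma> x = (if x \<le> Suc k then Suc (Suc k) else x))"
    if "Suc k < n" for k
    using that
  proof (induction k)
    case 0
    have "wrap n 2 = 2"
      using wrap_of_nat[of 2 n] n3 by simp
    then have "push n 1 x = (if x \<le> Suc 0 then Suc (Suc 0) else x)" if "x \<in> {1..n}" for x
      using that by (simp add: push_def)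
    then show ?case
      using p w_def by blast
  next
    case (Suc k)
    then obtain \<gamma> where \<gamma>: "\<gamma> \<in> carrier (OP n)" "\<phi> \<gamma> = w"
      "\<And>x. x \<in> {1..n} \<Longrightarrow> \<gamma> x = (if x \<le> Suc k then Suc (Suc k) else x)"
      by auto
    let ?a = "Suc (Suc k)"
    have a: "?a \<in> {1..n}"
      using Suc.prems by simp
    have wa: "wrap n (int ?a + 1) = Suc ?a"
      using wrap_of_nat[of "Suc ?a" n] Suc.prems by (simp add: add.commute)
    show ?case
    proof (intro bexI[of _ "\<gamma> \<otimes>\<^bsub>OP n\<^esub> push n ?a"] conjI ballI)
      show "\<phi> (\<gamma> \<otimes>\<^bsub>OP n\<^esub> push n ?a) = w"
        using endo_mult[OF \<gamma>(1) p] \<gamma>(2) push_w[OF a] w_idem by simp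
      fix x assume x: "x \<in> {1..n}"
      have "(\<gamma> \<otimes>\<^bsub>OP n\<^esub> push n ?a) x = (if \<gamma> x = ?a then Suc ?a else \<gamma> x)"
        using x OP_mem[OF \<gamma>(1) x] wa by (simp add: push_def)
      then show "(\<gamma> \<otimes>\<^bsub>OP n\<^esub> push n ?a) x = (if x \<le> Suc (Suc k) then Suc (Suc (Suc k)) else x)"
        using \<gamma>(3)[OF x] by auto
    qed (use \<gamma> p in auto)
  qed
  from this[of "n - 2"] obtain \<gamma> where \<gamma>: "\<gamma> \<in> carrier (OP n)" "\<phi> \<gamma> = w"
    "\<And>x. x \<in> {1..n} \<Longrightarrow> \<gamma> x = (if x \<le> n - 1 then n else x)"
    using n3 by (auto simp: Suc_diff_Suc numeral_2_eq_2)
  have n: "n \<in> {1..n}"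
    using n_pos by simp
  have "\<gamma> = const_map n n"
    using \<gamma>(3) by (intro OP_ext[OF \<gamma>(1) const_map_in_OP[OF n]]) (auto simp: const_map_def)
  then have w_f: "w = f"
    using \<gamma>(2) const[OF n] by simp
  have noninj: "\<phi> \<alpha> = f" if \<alpha>: "\<alpha> \<in> carrier (OP n)" and ni: "\<not> inj_on \<alpha> {1..n}" for \<alpha>
  proof -
    obtain a where a: "a \<in> {1..n}" "\<alpha> (wrap n (int a + 1)) = \<alpha> a"
      using OP_not_inj_adjacent[OF n_pos \<alpha> ni] by blast
    \<comment> \<open>\<open>\<alpha>\<close> does not distinguish \<open>a\<close> from its
      successor, so pushing \<open>a\<close> first changes nothing; this exhibits a left factor with
      image \<open>f\<close>.\<close>
    have "push n a \<otimes>\<^bsub>OP n\<^esub> \<alpha> = \<alpha>"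
      using a by (intro OP_ext[OF m_closed[OF p \<alpha>] \<alpha>]) (simp add: push_def)
    then have "\<phi> \<alpha> = f \<otimes>\<^bsub>OP n\<^esub> \<phi> \<alpha>"
      using endo_mult[OF p \<alpha>, of a] push_w[OF a(1)] w_f by simp
    then show ?thesis
      using f_mult[OF \<alpha>] by simp
  qed
  show thesis
  proof
    show "(e, f) \<in> idem_pairs n"
      using f_mult[OF one_closed] mult_f[OF one_closed] f_mult[OF c1] endo_closed[OF c1]
        endo_closed[OF one_closed] endo_mult[OF one_closed one_closed]
      by (simp add: idem_pairs_def idems_def e_def f_def)
    show "\<phi> \<alpha> = collapse_endo n e f \<alpha>" if \<alpha>: "\<alpha> \<in> carrier (OP n)" for \<alpha>
    proof (cases "inj_on \<alpha> {1..n}")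
      case True
      then obtain j where "\<alpha> = rot n j"
        using OP_inj_is_rot[OF n_pos \<alpha>] by blast
      then show ?thesis
        using True \<alpha> rot_e by (simp add: collapse_endo_def)
    next
      case False
      then show ?thesis
        using noninj[OF \<alpha> False] \<alpha> by (simp add: collapse_endo_def)
    qed
  qed
qed

end

section \<open>Counting the two families\<close>

lemma conj_endo_const:
  assumes "n > 0" "x \<in> {1..n}"
  shows "conj_endo n c s (const_map n x) = const_map n (wrap n (int c + s * int x))"
proof -
  have "const_map n x (wrap n z) = x" for z
    using wrap_in[OF assms(1), of z] by (simp add: const_map_def)
  then show ?thesis
    using const_map_in_OP[OF assms(2)]
    unfolding conj_endo_def by (simp add: const_map_def[of n "wrap n _"])
qed

lemma const_map_eq_iff: "n > 0 \<Longrightarrow> const_map n x = const_map n y \<longleftrightarrow> x = y"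
  by (metis (no_types) const_map_def restrict_apply' wrap_in)

lemma semigroup_endos_OP:
  assumes "n \<ge> 3"
  shows "semigroup_endos (OP n) =
    (\<lambda>(c, s). conj_endo n c s) ` ({1..n} \<times> {1, -1}) \<union> (\<lambda>(e, f). collapse_endo n e f) ` idem_pairs n"
    (is "_ = ?A \<union> ?B")
proof
  have n: "n > 0"
    using assms by simp
  show "?A \<union> ?B \<subseteq> semigroup_endos (OP n)"
    using conj_endo_hom[OF n] collapse_endo_hom[OF n] by auto
  show "semigroup_endos (OP n) \<subseteq> ?A \<union> ?B"
  proof
    fix \<phi> assume "\<phi> \<in> semigroup_endos (OP n)"
    then have hom: "\<phi> \<in> hom (OP n) (OP n)" and ext: "\<phi> \<in> extensional (carrier (OP n))"
      by (auto simp: semigroup_endos_def)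
    show "\<phi> \<in> ?A \<union> ?B"
    proof (cases "inj_on (\<lambda>x. \<phi> (const_map n x)) {1..n}")
      case True
      then obtain c s where cs: "c \<in> {1..n}" "s \<in> {1, -1}"
        "\<And>\<alpha>. \<alpha> \<in> carrier (OP n) \<Longrightarrow> \<phi> \<alpha> = conj_endo n c s \<alpha>"
        using endo_inj_on_consts[OF assms hom] by blast
      then have "\<phi> = conj_endo n c s"
        by (intro extensionalityI[OF ext]) (auto simp: conj_endo_def)
      then show ?thesis
        using cs by blast
    next
      case False
      then obtain e f where ef: "(e, f) \<in> idem_pairs n"
        "\<And>\<alpha>. \<alpha> \<in> carrier (OP n) \<Longrightarrow> \<phi> \<alpha> = collapse_endo n e f \<alpha>"
        using endo_not_inj_on_consts[OF assms hom] by blast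
      then have "\<phi> = collapse_endo n e f"
        by (intro extensionalityI[OF ext]) (auto simp: collapse_endo_def)
      then show ?thesis
        using ef by blast
    qed
  qed
qed

lemma const_not_inj: "n \<ge> 3 \<Longrightarrow> \<not> inj_on (const_map n x) {1..n}"
  using inj_onD[of "const_map n x" "{1..n}" 1 2] by (auto simp: const_map_def)

lemma finite_idem_pairs: "finite (idem_pairs n)"
  using finite_OP[of n] by (auto simp: idem_pairs_def idems_def)

lemma card_semigroup_endos_OP:
  assumes n3: "n \<ge> 3"
  shows "card (semigroup_endos (OP n)) = 2 * n + card (idem_pairs n)"
proof -
  have n: "n > 0"
    using n3 by simp
  interpret monoid "OP n"
    using monoid_OP[OF n] .
  let ?A = "(\<lambda>(c, s). conj_endo n c s) ` ({1..n} \<times> {1, -1})"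
    and ?B = "(\<lambda>(e, f). collapse_endo n e f) ` idem_pairs n"
  have vals: "wrap n (int c + s * int x) = wrap n (int c' + s' * int x)"
    if "conj_endo n c s = conj_endo n c' s'" "x \<in> {1..n}" for c s c' s' x
    using conj_endo_const[OF n that(2)] that(1) const_map_eq_iff[OF n] by metis
  have "inj_on (\<lambda>(c, s). conj_endo n c s) ({1..n} \<times> {1, -1})"
  proof (rule inj_onI, clarify)
    fix c c' and s s' :: int
    assume c: "c \<in> {1..n}" "c' \<in> {1..n}" and s: "s \<in> {1, -1}" "s' \<in> {1, -1}"
      and eq: "conj_endo n c s = conj_endo n c' s'"
    \<comment> \<open>The constant \<open>n\<close> removes \<open>s\<close> and gives
      \<open>c\<close> modulo \<open>n\<close>; the constant \<open>1\<close> then gives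
      \<open>s\<close>, as \<open>1\<close> and \<open>-1\<close> are incongruent modulo
      \<open>n \<ge> 3\<close>.\<close>
    have "c = c'"
      using vals[OF eq, of n] c n by simp
    moreover have "int c + s = int c' + s'"
      by (rule wrap_eq_window[OF n]) (use vals[OF eq, of 1] n n3 s \<open>c = c'\<close> in auto)
    ultimately show "c = c' \<and> s = s'"
      by simp
  qed
  then have A: "card ?A = 2 * n"
    by (simp add: card_image card_cartesian_product)
  have at_one: "collapse_endo n e f \<one>\<^bsub>OP n\<^esub> = e" for e f
    by (simp add: collapse_endo_def) (simp add: OP_def inj_on_def)
  have at_const: "collapse_endo n e f (const_map n x) = f" if "x \<in> {1..n}" for e f x
    using const_map_in_OP[OF that] const_not_inj[OF n3] by (simp add: collapse_endo_def)
  have one: "1 \<in> {1..n}" and two: "2 \<in> {1..n}"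
    using n3 by auto
  have "inj_on (\<lambda>(e, f). collapse_endo n e f) (idem_pairs n)"
    by (rule inj_onI) (use at_one at_const[OF one] in \<open>clarify, metis\<close>)
  then have B: "card ?B = card (idem_pairs n)"
    by (rule card_image)
  have "?A \<inter> ?B = {}"
  proof (rule ccontr)
    assume "?A \<inter> ?B \<noteq> {}"
    then obtain c s e f where s: "s \<in> {1, -1}" and eq: "conj_endo n c s = collapse_endo n e f"
      by auto
    \<comment> \<open>A conjugation separates the constants \<open>1\<close> and \<open>2\<close>; a
      collapsing endomorphism does not.\<close>
    have "const_map n (wrap n (int c + s * int 1)) = const_map n (wrap n (int c + s * int 2))"
      using conj_endo_const[OF n one] conj_endo_const[OF n two] at_const[OF one] at_const[OF two] eq
      by metis
    then have "int c + s * int 1 = int c + s * int 2"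
      by (intro wrap_eq_window[OF n]) (use s n3 const_map_eq_iff[OF n] in auto)
    then show False
      using s by auto
  qed
  then have "card (?A \<union> ?B) = card ?A + card ?B"
    using finite_idem_pairs by (intro card_Un_disjoint) auto
  then show ?thesis
    using A B semigroup_endos_OP[OF n3] by simp
qed

section \<open>Idempotents below an idempotent\<close>

lemma OP_mult_eq_iff:
  assumes "n > 0" "\<alpha> \<in> carrier (OP n)" "\<beta> \<in> carrier (OP n)" "\<gamma> \<in> carrier (OP n)"
  shows "\<alpha> \<otimes>\<^bsub>OP n\<^esub> \<beta> = \<gamma> \<longleftrightarrow> (\<forall>x\<in>{1..n}. \<beta> (\<alpha> x) = \<gamma> x)"
proof
  show "\<forall>x\<in>{1..n}. \<beta> (\<alpha> x) = \<gamma> x" if "\<alpha> \<otimes>\<^bsub>OP n\<^esub> \<beta> = \<gamma>"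
    using that OP_mult_apply by metis
  show "\<alpha> \<otimes>\<^bsub>OP n\<^esub> \<beta> = \<gamma>" if *: "\<forall>x\<in>{1..n}. \<beta> (\<alpha> x) = \<gamma> x"
    by (rule OP_ext[OF monoid.m_closed[OF monoid_OP[OF assms(1)] assms(2,3)] assms(4)]) (use * in simp)
qed

lemma idems_iff:
  assumes "n > 0"
  shows "e \<in> idems n \<longleftrightarrow> e \<in> carrier (OP n) \<and> (\<forall>x\<in>{1..n}. e (e x) = e x)"
  using OP_mult_eq_iff[OF assms, of e e e] by (auto simp: idems_def)

text \<open>Idempotents below \<open>e\<close> map into the image \<open>A\<close> of
  \<open>e\<close> and factor through \<open>e\<close>, so they are determined on \<open>A\<close>.
  Numbering \<open>A\<close> increasingly turns these restrictions into idempotents of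
  \<open>OP k\<close> with \<open>k = card A\<close>; lifts compose across the numbering.\<close>

lemma card_idems_below:
  assumes n: "n > 0" and e: "e \<in> idems n"
  shows "card {f \<in> idems n. e \<otimes>\<^bsub>OP n\<^esub> f = f \<and> f \<otimes>\<^bsub>OP n\<^esub> e = f} = card (idems (card (e ` {1..n})))"
    (is "card ?L = card (idems ?k)")
proof -
  define A where "A = e ` {1..n}"
  define k where "k = card A"
  have eC: "e \<in> carrier (OP n)" and ee: "\<And>x. x \<in> {1..n} \<Longrightarrow> e (e x) = e x"
    using e idems_iff[OF n] by auto
  have A: "A \<subseteq> {1..n}" "finite A"
    using OP_mem[OF eC] by (auto simp: A_def)
  have eA: "e a = a" if "a \<in> A" for a
    using that ee by (auto simp: A_def)
  have k: "k > 0"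
    using A n by (auto simp: k_def card_gt_0_iff A_def)
  obtain h where h: "bij_betw h {..<k} A" "strict_mono_on {..<k} h"
    using ex_bij_betw_strict_mono_card[OF A(2)] unfolding k_def by blast
  \<comment> \<open>\<open>h\<close> counts from \<open>0\<close>, the points of \<open>OP k\<close>
    from \<open>1\<close>.\<close>
  define \<sigma> where "\<sigma> j = h (j - 1)" for j
  have \<sigma>_mono: "\<sigma> i < \<sigma> j \<longleftrightarrow> i < j" if "i \<in> {1..k}" "j \<in> {1..k}" for i j
  proof -
    have "h (i - 1) < h (j - 1) \<longleftrightarrow> i - 1 < j - 1"
      using that by (intro strict_mono_on_less[OF h(2)]) auto
    then show ?thesis
      using that by (auto simp: \<sigma>_def)
  qed
  have \<sigma>_A: "\<sigma> j \<in> A" if "j \<in> {1..k}" for j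
    using that h(1) by (auto simp: \<sigma>_def bij_betw_def)
  have \<sigma>_surj: "\<exists>j\<in>{1..k}. \<sigma> j = a" if "a \<in> A" for a
  proof -
    have "a \<in> h ` {..<k}"
      using that h(1) by (simp add: bij_betw_def)
    then obtain i where "i < k" "h i = a"
      by auto
    then show ?thesis
      by (intro bexI[of _ "Suc i"]) (auto simp: \<sigma>_def)
  qed
  \<comment> \<open>A monotone left inverse of \<open>\<sigma>\<close>: the position of
    \<open>y\<close> relative to \<open>A\<close>. The \<open>max 1\<close> covers points below the
    least element of \<open>A\<close>, where the count is \<open>0\<close>.\<close>
  define \<tau> where "\<tau> y = max 1 (card {a \<in> A. a \<le> y})" for y
  have \<tau>_mem: "\<tau> y \<in> {1..k}" for y
    using k card_mono[OF A(2), of "{a \<in> A. a \<le> y}"] by (auto simp: \<tau>_def k_def)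
  have \<tau>\<sigma>: "\<tau> (\<sigma> j) = j" if j: "j \<in> {1..k}" for j
  proof -
    have "{a \<in> A. a \<le> \<sigma> j} = \<sigma> ` {1..j}"
    proof
      show "\<sigma> ` {1..j} \<subseteq> {a \<in> A. a \<le> \<sigma> j}"
      proof (rule image_subsetI)
        fix i assume "i \<in> {1..j}"
        then show "\<sigma> i \<in> {a \<in> A. a \<le> \<sigma> j}"
          using \<sigma>_A[of i] \<sigma>_mono[of i j] j by (cases "i = j") auto
      qed
      show "{a \<in> A. a \<le> \<sigma> j} \<subseteq> \<sigma> ` {1..j}"
      proof
        fix a assume a: "a \<in> {a \<in> A. a \<le> \<sigma> j}"
        then obtain i where i: "i \<in> {1..k}" "\<sigma> i = a"
          using \<sigma>_surj by blast
        then have "\<not> j < i"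
          using \<sigma>_mono[OF j i(1)] a by auto
        then show "a \<in> \<sigma> ` {1..j}"
          using i by auto
      qed
    qed
    moreover have "inj_on \<sigma> {1..j}"
    proof (rule inj_onI)
      fix i i' assume "i \<in> {1..j}" "i' \<in> {1..j}" "\<sigma> i = \<sigma> i'"
      then show "i = i'"
        using \<sigma>_mono[of i i'] \<sigma>_mono[of i' i] j by (cases i i' rule: linorder_cases) auto
    qed
    ultimately have "card {a \<in> A. a \<le> \<sigma> j} = j"
      by (simp add: card_image)
    then show ?thesis
      using j by (simp add: \<tau>_def)
  qed
  have \<sigma>\<tau>: "\<sigma> (\<tau> a) = a" if "a \<in> A" for a
    using \<sigma>_surj[OF that] \<tau>\<sigma> by auto
  have \<sigma>_mem: "\<sigma> j \<in> {1..n}" if "j \<in> {1..k}" for j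
    using \<sigma>_A[OF that] A by blast
  obtain S where S: "is_lift k n S \<sigma>"
  proof -
    have "mono_on {1..k} \<sigma>"
    proof (rule mono_onI)
      show "\<sigma> i \<le> \<sigma> j" if "i \<in> {1..k}" "j \<in> {1..k}" "i \<le> j" for i j
        using \<sigma>_mono[OF that(1,2)] that by (cases "i = j") auto
    qed
    then show thesis
      using mono_on_has_lift[OF k n, of \<sigma>] \<sigma>_mem that by blast
  qed
  obtain T where T: "is_lift n k T \<tau>"
  proof -
    have "mono_on {1..n} \<tau>"
    proof (rule mono_onI)
      show "\<tau> x \<le> \<tau> y" if "x \<le> y" for x y
      proof -
        have "card {a \<in> A. a \<le> x} \<le> card {a \<in> A. a \<le> y}"
          using A that by (intro card_mono) auto
        then show ?thesis
          by (auto simp: \<tau>_def)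
      qed
    qed
    then show thesis
      using mono_on_has_lift[OF n k, of \<tau>] \<tau>_mem that by blast
  qed
  obtain E where E: "is_lift n n E e"
    using carrier_OP_iff[OF n] eC by blast
  \<comment> \<open>\<open>?up\<close> retracts by \<open>e\<close> and then acts as
    \<open>\<beta>\<close> on the numbered set \<open>A\<close>; \<open>?down\<close> restricts to
    \<open>A\<close> and renumbers.\<close>
  let ?up = "\<lambda>\<beta>. \<lambda>x\<in>{1..n}. \<sigma> (\<beta> (\<tau> (e x)))"
  let ?down = "\<lambda>f. \<lambda>j\<in>{1..k}. \<tau> (f (\<sigma> j))"
  have L: "f \<in> ?L \<longleftrightarrow> f \<in> carrier (OP n) \<and>
      (\<forall>x\<in>{1..n}. f (f x) = f x \<and> f (e x) = f x \<and> e (f x) = f x)" for f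
    using idems_iff[OF n, of f] OP_mult_eq_iff[OF n, of e f f] OP_mult_eq_iff[OF n, of f e f] eC by blast
  have "bij_betw ?up (idems k) ?L"
  proof (rule bij_betw_byWitness[where f' = ?down])
    show "\<forall>\<beta>\<in>idems k. ?down (?up \<beta>) = \<beta>"
    proof
      fix \<beta> assume "\<beta> \<in> idems k"
      then have \<beta>: "\<beta> \<in> carrier (OP k)"
        using idems_iff[OF k] by blast
      then have "\<beta> \<in> extensional {1..k}"
        by (auto simp: OP_def PiE_def)
      moreover have "?down (?up \<beta>) j = \<beta> j" if j: "j \<in> {1..k}" for j
        using j \<sigma>_mem[OF j] eA[OF \<sigma>_A[OF j]] \<tau>\<sigma>[OF j] \<tau>\<sigma>[OF OP_mem[OF \<beta> j]] by simp
      ultimately show "?down (?up \<beta>) = \<beta>"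
        by (intro extensionalityI[of _ "{1..k}"]) auto
    qed
    show "\<forall>f\<in>?L. ?up (?down f) = f"
    proof
      fix f assume f: "f \<in> ?L"
      then have fC: "f \<in> carrier (OP n)" and ef: "\<And>x. x \<in> {1..n} \<Longrightarrow> e (f x) = f x"
        and fe: "\<And>x. x \<in> {1..n} \<Longrightarrow> f (e x) = f x"
        using L by blast+
      then have "f \<in> extensional {1..n}"
        by (auto simp: OP_def PiE_def)
      moreover have "?up (?down f) x = f x" if x: "x \<in> {1..n}" for x
      proof -
        have A_mem: "e x \<in> A" "f x \<in> A"
          using x imageI[OF OP_mem[OF fC x], of e] ef[OF x] by (simp_all add: A_def)
        show ?thesis
          using x fe[OF x] \<tau>_mem[of "e x"] \<sigma>\<tau>[OF A_mem(1)] \<sigma>\<tau>[OF A_mem(2)] by simp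
      qed
      ultimately show "?up (?down f) = f"
        by (intro extensionalityI[of _ "{1..n}"]) auto
    qed
    show "?up ` idems k \<subseteq> ?L"
    proof (rule image_subsetI)
      fix \<beta> assume "\<beta> \<in> idems k"
      then have \<beta>: "\<beta> \<in> carrier (OP k)" and \<beta>\<beta>: "\<And>j. j \<in> {1..k} \<Longrightarrow> \<beta> (\<beta> j) = \<beta> j"
        using idems_iff[OF k] by auto
      obtain B where B: "is_lift k k B \<beta>"
        using carrier_OP_iff[OF k] \<beta> by blast
      have "is_lift n n (S \<circ> (B \<circ> (T \<circ> E))) (\<lambda>x. \<sigma> (\<beta> (\<tau> (e x))))"
        using is_lift_comp[OF is_lift_comp[OF is_lift_comp[OF E T n refl] B k refl] S k refl] .
      then have C: "?up \<beta> \<in> carrier (OP n)"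
        using restrict_in_OP[OF n] by blast
      have "?up \<beta> (?up \<beta> x) = ?up \<beta> x \<and> ?up \<beta> (e x) = ?up \<beta> x \<and> e (?up \<beta> x) = ?up \<beta> x"
        if x: "x \<in> {1..n}" for x
      proof -
        have j: "\<beta> (\<tau> (e x)) \<in> {1..k}"
          using OP_mem[OF \<beta> \<tau>_mem] .
        show ?thesis
          using x \<sigma>_mem[OF j] eA[OF \<sigma>_A[OF j]] \<tau>\<sigma>[OF j] \<beta>\<beta>[OF \<tau>_mem] ee[OF x] OP_mem[OF eC x]
          by simp
      qed
      then show "?up \<beta> \<in> ?L"
        unfolding L using C by blast
    qed
    show "?down ` ?L \<subseteq> idems k"
    proof (rule image_subsetI)
      fix f assume f: "f \<in> ?L"
      then have fC: "f \<in> carrier (OP n)"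
        using L by blast
      obtain F where F: "is_lift n n F f"
        using carrier_OP_iff[OF n] fC by blast
      have "is_lift k k (T \<circ> (F \<circ> S)) (\<lambda>j. \<tau> (f (\<sigma> j)))"
        using is_lift_comp[OF is_lift_comp[OF S F n refl] T n refl] .
      then have "?down f \<in> carrier (OP k)"
        using restrict_in_OP[OF k] by blast
      moreover have "?down f (?down f j) = ?down f j" if j: "j \<in> {1..k}" for j
      proof -
        have s: "\<sigma> j \<in> {1..n}"
          using \<sigma>_mem[OF j] .
        then have "e (f (\<sigma> j)) = f (\<sigma> j)" "f (f (\<sigma> j)) = f (\<sigma> j)"
          using f L by blast+
        moreover from this have "f (\<sigma> j) \<in> A"
          using OP_mem[OF fC s] unfolding A_def by (metis imageI)
        ultimately show ?thesis
          using j \<tau>_mem[of "f (\<sigma> j)"] \<sigma>\<tau> by simp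
      qed
      ultimately show "?down f \<in> idems k"
        using idems_iff[OF k] by blast
    qed
  qed
  then have "card (idems k) = card ?L"
    by (rule bij_betw_same_card)
  then show ?thesis
    by (simp only: k_def A_def)
qed

section \<open>Binomial and Fibonacci sums\<close>

text \<open>A hockey-stick sum: each induction step is one application of Pascal's rule.\<close>

lemma sum_choose_diagonal:
  assumes "m > 0"
  shows "(\<Sum>t\<le>N. (t + m - 1) choose (2 * m - 1)) = (N + m) choose (2 * m)"
proof (induction N)
  case 0
  then show ?case
    using assms by (simp add: binomial_eq_0)
next
  case (Suc N)
  obtain m' where "m = Suc m'"
    using assms gr0_implies_Suc by blast
  then show ?case
    using Suc by simp
qed

text \<open>Passing from \<open>N\<close> to \<open>N + 1\<close> adds the unweighted diagonal sum,
  and Pascal's rule closes the induction. This solves the first-block recursion for order-preserving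
  idempotents.\<close>

lemma sum_weighted_choose:
  assumes "m > 0"
  shows "(\<Sum>s = 1..N. s * ((N - s + m - 1) choose (2 * m - 1))) = (N + m) choose (2 * m + 1)"
proof -
  define b where "b t = (t + m - 1) choose (2 * m - 1)" for t
  have "(\<Sum>s = 1..N. s * b (N - s)) = (N + m) choose (2 * m + 1)"
  proof (induction N)
    case 0
    then show ?case
      using assms by (simp add: binomial_eq_0)
  next
    case (Suc N)
    have "(\<Sum>s = 1..Suc N. s * b (Suc N - s)) = (\<Sum>s = 0..N. Suc s * b (N - s))"
      by (rule sum.reindex_bij_witness[of _ Suc "\<lambda>s. s - 1"]) auto
    also have "\<dots> = (\<Sum>s = 0..N. s * b (N - s)) + (\<Sum>s = 0..N. b (N - s))"
      by (simp add: sum.distrib add.commute)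
    also have "(\<Sum>s = 0..N. s * b (N - s)) = (\<Sum>s = 1..N. s * b (N - s))"
      by (simp add: sum.atLeast_Suc_atMost)
    also have "(\<Sum>s = 0..N. b (N - s)) = (\<Sum>t\<le>N. b t)"
      by (rule sum.reindex_bij_witness[of _ "\<lambda>t. N - t" "\<lambda>t. N - t"]) auto
    also have "\<dots> = (N + m) choose (2 * m)"
      unfolding b_def by (rule sum_choose_diagonal[OF assms])
    finally show ?case
      using Suc by simp
  qed
  then show ?thesis
    by (simp add: b_def)
qed

text \<open>Read backwards and rewritten by binomial symmetry, this is a shallow diagonal of
  Pascal's triangle.\<close>

lemma sum_choose_eq_fib_even: "(\<Sum>m<N. (N + m) choose (2 * m + 1)) = fib (2 * N)"
proof (cases N)
  case (Suc M)
  have "(\<Sum>m<N. (N + m) choose (2 * m + 1)) = (\<Sum>k<N. (2 * M + 1 - k) choose k)"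
  proof (rule sum.reindex_bij_witness[of _ "\<lambda>k. M - k" "\<lambda>m. M - m"])
    fix m assume m: "m \<in> {..<N}"
    then have "2 * M + 1 - (M - m) = N + m" "N + m - (2 * m + 1) = M - m"
      using Suc by auto
    then show "(2 * M + 1 - (M - m) choose (M - m)) = (N + m choose (2 * m + 1))"
      using m Suc binomial_symmetric[of "2 * m + 1" "N + m"] by simp
  qed (use Suc in auto)
  also have "\<dots> = (\<Sum>k = 0..2 * M + 1. (2 * M + 1 - k) choose k)"
    by (rule sum.mono_neutral_left) (use Suc in \<open>auto simp: binomial_eq_0\<close>)
  also have "\<dots> = fib (2 * N)"
    using ne_diagonal_fib[of "2 * M + 1"] Suc by simp
  finally show ?thesis .
qed simp

text \<open>First of three sums, with weights the powers 0, 1 and 2 of \<open>n - t\<close>; raising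
  \<open>n\<close> changes each of the later two by a combination of the earlier ones.\<close>

lemma sum_fib_even:
  "int (\<Sum>t\<le>n. fib (2 * t)) = int (fib (2 * n + 1)) - 1"
  by (induction n) auto

lemma sum_linear_fib_even:
  "(\<Sum>t\<le>n. int (n - t) * int (fib (2 * t))) = int (fib (2 * n)) - int n"
proof (induction n)
  case (Suc n)
  have "(\<Sum>t\<le>Suc n. int (Suc n - t) * int (fib (2 * t))) =
      (\<Sum>t\<le>n. int (n - t) * int (fib (2 * t)) + int (fib (2 * t)))"
    by (simp add: Suc_diff_le algebra_simps)
  also have "\<dots> = int (fib (2 * n)) - int n + (int (fib (2 * n + 1)) - 1)"
    unfolding sum.distrib Suc using sum_fib_even[of n] by simp
  finally show ?case
    by simp
qed simp

lemma sum_square_fib_even: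
  "n > 0 \<Longrightarrow> (\<Sum>t\<le>n. (int (n - t))\<^sup>2 * int (fib (2 * t))) =
    int (fib (2 * n - 1)) + int (fib (2 * n + 1)) - (int n)\<^sup>2 - 2"
proof (induction n rule: nat_induct_non_zero)
  case 1
  then show ?case
    by (simp add: eval_nat_numeral)
next
  case (Suc n)
  have "(\<Sum>t\<le>Suc n. (int (Suc n - t))\<^sup>2 * int (fib (2 * t))) =
      (\<Sum>t\<le>n. (int (n - t))\<^sup>2 * int (fib (2 * t)) +
        (2 * (int (n - t) * int (fib (2 * t))) + int (fib (2 * t))))"
    by (simp add: Suc_diff_le algebra_simps power2_eq_square)
  also have "\<dots> = int (fib (2 * n - 1)) + int (fib (2 * n + 1)) - (int n)\<^sup>2 - 2 +
      (2 * (int (fib (2 * n)) - int n) + (int (fib (2 * n + 1)) - 1))"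
    unfolding sum.distrib Suc.IH sum_distrib_left[symmetric] sum_linear_fib_even
    using sum_fib_even[of n] by simp
  also have "\<dots> = int (fib (2 * Suc n - 1)) + int (fib (2 * Suc n + 1)) - (int (Suc n))\<^sup>2 - 2"
  proof -
    \<comment> \<open>Positivity of \<open>n\<close> enters here: truncated subtraction breaks the
      recurrence at \<open>0\<close>.\<close>
    have "fib (2 * n + 1) = fib (2 * n) + fib (2 * n - 1)"
      using Suc.hyps by (cases n) auto
    then show ?thesis
      by (simp add: power2_eq_square algebra_simps)
  qed
  finally show ?case .
qed

text \<open>After exchanging the sums, the sum over \<open>k\<close> at fixed \<open>i\<close> is
  \<open>fib (2 * (n - i))\<close>, leaving the square-weighted Fibonacci sum. The left side will be
  the number of idempotents of \<open>OP n\<close>, sorted by rank.\<close>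

lemma sum_square_choose_eq_fib:
  assumes "n > 0"
  shows "int n + (\<Sum>k = 2..n. \<Sum>i = 1..<n. (int i)\<^sup>2 * int ((n - i + k - 2) choose (2 * k - 3))) =
    int (fib (2 * n - 1)) + int (fib (2 * n + 1)) - (int n)\<^sup>2 + int n - 2"
proof -
  have inner: "(\<Sum>k = 2..n. int ((n - i + k - 2) choose (2 * k - 3))) = int (fib (2 * (n - i)))"
    if i: "i \<in> {1..<n}" for i
  proof -
    have "(\<Sum>k = 2..n. (n - i + k - 2) choose (2 * k - 3)) = (\<Sum>m<n - 1. (n - i + m) choose (2 * m + 1))"
      by (rule sum.reindex_bij_witness[of _ "\<lambda>m. m + 2" "\<lambda>k. k - 2"])
        (auto simp: algebra_simps Suc_diff_Suc numeral_eq_Suc)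
    also have "\<dots> = (\<Sum>m<n - i. (n - i + m) choose (2 * m + 1))"
      \<comment> \<open>For \<open>m \<ge> n - i\<close> the lower index exceeds the upper
        one.\<close>
      by (rule sum.mono_neutral_right) (use i in \<open>auto simp: binomial_eq_0\<close>)
    finally show ?thesis
      unfolding of_nat_sum[symmetric] using sum_choose_eq_fib_even[of "n - i"] by simp
  qed
  have "(\<Sum>k = 2..n. \<Sum>i = 1..<n. (int i)\<^sup>2 * int ((n - i + k - 2) choose (2 * k - 3))) =
      (\<Sum>i = 1..<n. (int i)\<^sup>2 * (\<Sum>k = 2..n. int ((n - i + k - 2) choose (2 * k - 3))))"
    unfolding sum_distrib_left by (rule sum.swap)
  also have "\<dots> = (\<Sum>i = 1..<n. (int i)\<^sup>2 * int (fib (2 * (n - i))))"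
    using inner by (intro sum.cong) auto
  also have "\<dots> = (\<Sum>t = 1..<n. (int (n - t))\<^sup>2 * int (fib (2 * t)))"
    by (rule sum.reindex_bij_witness[of _ "\<lambda>t. n - t" "\<lambda>t. n - t"]) auto
  also have "\<dots> = (\<Sum>t\<le>n. (int (n - t))\<^sup>2 * int (fib (2 * t)))"
    by (rule sum.mono_neutral_left) (auto simp: not_less Suc_le_eq)
  finally show ?thesis
    using sum_square_fib_even[OF assms] by simp
qed

section \<open>Idempotents of given rank\<close>

text \<open>Both endpoints are parameters since the recursion cuts off an initial block; the
  half-open form admits an empty remainder.\<close>

definition ord_idems :: "nat \<Rightarrow> nat \<Rightarrow> nat \<Rightarrow> (nat \<Rightarrow> nat) set" where
  "ord_idems a b m = {g \<in> {a..<b} \<rightarrow>\<^sub>E {a..<b}. mono_on {a..<b} g \<and>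
     (\<forall>x\<in>{a..<b}. g (g x) = g x) \<and> card (g ` {a..<b}) = m}"

lemma ord_idemsD:
  assumes "g \<in> ord_idems a b m"
  shows "x \<in> {a..<b} \<Longrightarrow> a \<le> g x" "x \<in> {a..<b} \<Longrightarrow> g x < b"
    "x \<in> {a..<b} \<Longrightarrow> g (g x) = g x"
    "x \<in> {a..<b} \<Longrightarrow> y \<in> {a..<b} \<Longrightarrow> x \<le> y \<Longrightarrow> g x \<le> g y"
    "card (g ` {a..<b}) = m" "g \<in> extensional {a..<b}"
  using assms by (auto simp: ord_idems_def PiE_def Pi_iff mono_on_def)

lemma ord_idemsI:
  assumes "g \<in> extensional {a..<b}" "\<And>x. x \<in> {a..<b} \<Longrightarrow> g x \<in> {a..<b}"
    "\<And>x y. x \<in> {a..<b} \<Longrightarrow> y \<in> {a..<b} \<Longrightarrow> x \<le> y \<Longrightarrow> g x \<le> g y"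
    "\<And>x. x \<in> {a..<b} \<Longrightarrow> g (g x) = g x" "card (g ` {a..<b}) = m"
  shows "g \<in> ord_idems a b m"
  using assms by (auto simp: ord_idems_def PiE_def Pi_iff mono_on_def)

lemma finite_ord_idems: "finite (ord_idems a b m)"
proof (rule finite_subset)
  show "ord_idems a b m \<subseteq> {a..<b} \<rightarrow>\<^sub>E {a..<b}"
    by (auto simp: ord_idems_def)
qed (simp add: finite_PiE)

text \<open>Rank \<open>0\<close> stops the block recursion: it forces the remainder to be empty,
  where exactly one extensional function exists.\<close>

lemma card_ord_idems_0: "card (ord_idems a (a + N) 0) = (if N = 0 then 1 else 0)"
proof (cases "N = 0")
  case True
  then have "ord_idems a (a + N) 0 = {\<lambda>x. undefined}"
    by (auto simp: ord_idems_def)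
  then show ?thesis
    using True by simp
next
  case False
  then have "ord_idems a (a + N) 0 = {}"
    by (auto simp: ord_idems_def)
  then show ?thesis
    using False by simp
qed

text \<open>An order-preserving idempotent is determined by its first block \<open>{a..<a+s}\<close>, the value there
  and the idempotent induced on the remaining points.\<close>

lemma card_ord_idems_Suc:
  "card (ord_idems a (a + N) (Suc m)) = (\<Sum>s = 1..N. s * card (ord_idems (a + s) (a + N) m))"
proof -
  define b where "b = a + N"
  define D where "D = (SIGMA s:{1..N}. {a..<a + s} \<times> ord_idems (a + s) b m)"
  define glue :: "nat \<times> nat \<times> (nat \<Rightarrow> nat) \<Rightarrow> nat \<Rightarrow> nat"
    where "glue = (\<lambda>(s, v, g). \<lambda>x\<in>{a..<b}. if x < a + s then v else g x)"
  have glue_apply: "glue (s, v, g) x = (if x < a + s then v else g x)" if "x \<in> {a..<b}" for s v g x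
    using that by (simp add: glue_def)
  have "bij_betw glue D (ord_idems a b (Suc m))"
    unfolding bij_betw_def
  proof
    show "inj_on glue D"
    proof (rule inj_onI)
      fix d d' assume d: "d \<in> D" "d' \<in> D" "glue d = glue d'"
      obtain s v g s' v' g' where dd: "d = (s, v, g)" "d' = (s', v', g')"
        by (metis prod_cases3)
      have s: "s \<in> {1..N}" "s' \<in> {1..N}" and v: "v \<in> {a..<a + s}" "v' \<in> {a..<a + s'}"
        and g: "g \<in> ord_idems (a + s) b m" "g' \<in> ord_idems (a + s') b m"
        using d dd by (auto simp: D_def)
      have eq: "(if x < a + s then v else g x) = (if x < a + s' then v' else g' x)" if "x \<in> {a..<b}" for x
        using d(3) dd glue_apply[OF that] by metis
      have vv: "v = v'"
        using eq[of a] s by (auto simp: b_def)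
      \<comment> \<open>At \<open>a + s\<close> the map with the shorter first block takes a value
        at least \<open>a + s\<close>, while the other still takes \<open>v < a + s\<close>.\<close>
      have "\<not> s < s'"
      proof
        assume "s < s'"
        then have x: "a + s \<in> {a + s..<b}"
          using s by (auto simp: b_def)
        then show False
          using eq[of "a + s"] ord_idemsD(1)[OF g(1) x] v vv \<open>s < s'\<close> by auto
      qed
      moreover have "\<not> s' < s"
      proof
        assume "s' < s"
        then have x: "a + s' \<in> {a + s'..<b}"
          using s by (auto simp: b_def)
        then show False
          using eq[of "a + s'"] ord_idemsD(1)[OF g(2) x] v vv \<open>s' < s\<close> by auto
      qed
      ultimately have ss: "s = s'"
        by simp
      have "g = g'"
      proof (rule extensionalityI[of _ "{a + s..<b}"])
        show "g x = g' x" if "x \<in> {a + s..<b}" for x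
          using eq[of x] that ss by auto
      qed (use ord_idemsD(6) g ss in auto)
      then show "d = d'"
        using dd vv ss by simp
    qed
    show "glue ` D = ord_idems a b (Suc m)"
    proof
      show "glue ` D \<subseteq> ord_idems a b (Suc m)"
      proof (rule image_subsetI)
        fix d assume "d \<in> D"
        then obtain s v g where d: "d = (s, v, g)" and s: "s \<in> {1..N}" and v: "v \<in> {a..<a + s}"
          and g: "g \<in> ord_idems (a + s) b m"
          by (auto simp: D_def)
        note gD = ord_idemsD[OF g]
        have split: "{a..<b} = {a..<a + s} \<union> {a + s..<b}"
          using s by (auto simp: b_def)
        have "glue d ` {a..<a + s} = {v}"
          unfolding d using s by (force simp: glue_def b_def)
        moreover have "glue d ` {a + s..<b} = g ` {a + s..<b}"
          unfolding d by (intro image_cong) (auto simp: glue_def)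
        ultimately have im: "glue d ` {a..<b} = insert v (g ` {a + s..<b})"
          unfolding split image_Un by simp
        have vg: "v \<notin> g ` {a + s..<b}"
          using gD(1) v by force
        show "glue d \<in> ord_idems a b (Suc m)"
        proof (rule ord_idemsI)
          show "glue d \<in> extensional {a..<b}"
            unfolding d by (simp add: glue_def)
          show mem: "glue d x \<in> {a..<b}" if "x \<in> {a..<b}" for x
            using glue_apply[OF that, of s v g] that v s gD(1,2)[of x] d by (auto simp: b_def)
          show "glue d x \<le> glue d y" if "x \<in> {a..<b}" "y \<in> {a..<b}" "x \<le> y" for x y
            using glue_apply[OF that(1), of s v g] glue_apply[OF that(2), of s v g] that v
              gD(1)[of y] gD(4)[of x y] d by auto
          show "glue d (glue d x) = glue d x" if "x \<in> {a..<b}" for x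
            using glue_apply[OF that, of s v g] glue_apply[OF mem[OF that], of s v g] that v
              gD(1)[of x] gD(3)[of x] d by (auto split: if_splits)
          show "card (glue d ` {a..<b}) = Suc m"
            unfolding im using vg gD(5) by simp
        qed
      qed
      show "ord_idems a b (Suc m) \<subseteq> glue ` D"
      proof
        fix f assume f: "f \<in> ord_idems a b (Suc m)"
        note fD = ord_idemsD[OF f]
        have ab: "a < b"
          using fD(5) by (metis atLeastLessThan_empty card.empty image_empty linorder_not_le nat.distinct(1))
        define v where "v = f a"
        define C where "C = {x \<in> {a..<b}. f x = v}"
        \<comment> \<open>Monotonicity makes the fibre over \<open>f a\<close> an initial segment,
          so its maximum determines the block length.\<close>
        define M where "M = Max C"
        have C: "finite C" "a \<in> C"
          using ab by (auto simp: C_def v_def)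
        have "M \<in> C"
          unfolding M_def using C by (intro Max_in) auto
        then have M: "M \<in> {a..<b}" "f M = v"
          by (auto simp: C_def)
        have vC: "v \<in> C"
          using fD(1-3)[of a] ab by (auto simp: C_def v_def)
        have low: "x \<le> M \<longleftrightarrow> f x = v" if x: "x \<in> {a..<b}" for x
        proof
          assume "x \<le> M"
          then show "f x = v"
            using fD(4)[of a x] fD(4)[OF x M(1)] M(2) x by (auto simp: v_def)
        next
          assume "f x = v"
          then show "x \<le> M"
            unfolding M_def using C x by (intro Max_ge) (auto simp: C_def)
        qed
        define s where "s = Suc M - a"
        have s: "s \<in> {1..N}" "a + s = Suc M"
          using M by (auto simp: s_def b_def)
        have vM: "v \<in> {a..<a + s}"
          using vC low[of v] s(2) by (auto simp: C_def)
        define g where "g = restrict f {a + s..<b}"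
        \<comment> \<open>A value \<open>f x\<close> inside the first block would give
          \<open>f x = f (f x) = v\<close>, placing \<open>x\<close> in that block too.\<close>
        have hi: "a + s \<le> f x" if "x \<in> {a + s..<b}" for x
        proof -
          have x: "x \<in> {a..<b}" "\<not> x \<le> M"
            using that s by auto
          then have "f (f x) \<noteq> v"
            using low[OF x(1)] fD(3)[OF x(1)] by simp
          then show ?thesis
            using low[of "f x"] fD(1,2)[OF x(1)] s(2) by auto
        qed
        have fglue: "f = glue (s, v, g)"
        proof (rule extensionalityI[of _ "{a..<b}"])
          show "f x = glue (s, v, g) x" if x: "x \<in> {a..<b}" for x
            using glue_apply[OF x, of s v g] low[OF x] x s(2) by (auto simp: g_def)
        qed (use fD(6) in \<open>auto simp: glue_def\<close>)
        have "{a..<b} = {a..<a + s} \<union> {a + s..<b}"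
          using s by (auto simp: b_def)
        moreover have "f ` {a..<a + s} = {v}"
        proof -
          have "f x = v" if "x \<in> {a..<a + s}" for x
            using low[of x] that s M(1) by auto
          moreover have "a \<in> {a..<a + s}"
            using s by auto
          ultimately show ?thesis
            by blast
        qed
        moreover have "g ` {a + s..<b} = f ` {a + s..<b}"
          by (simp add: g_def)
        ultimately have im: "f ` {a..<b} = insert v (g ` {a + s..<b})"
          by (simp add: image_Un)
        have "v \<notin> g ` {a + s..<b}"
          using hi vM by (force simp: g_def)
        then have card: "card (g ` {a + s..<b}) = m"
          using fD(5) im by simp
        have "g \<in> ord_idems (a + s) b m"
        proof (rule ord_idemsI[OF _ _ _ _ card])
          show "g \<in> extensional {a + s..<b}"
            by (simp add: g_def)
          show "g x \<in> {a + s..<b}" if "x \<in> {a + s..<b}" for x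
            using that hi[OF that] fD(2)[of x] by (auto simp: g_def)
          show "g x \<le> g y" if "x \<in> {a + s..<b}" "y \<in> {a + s..<b}" "x \<le> y" for x y
            using that fD(4)[of x y] by (auto simp: g_def)
          show "g (g x) = g x" if "x \<in> {a + s..<b}" for x
            using that hi[OF that] fD(2)[of x] fD(3)[of x] by (auto simp: g_def)
        qed
        then have "(s, v, g) \<in> D"
          using s vM by (simp add: D_def)
        then show "f \<in> glue ` D"
          using fglue by blast
      qed
    qed
  qed
  then have "card (ord_idems a b (Suc m)) = card D"
    using bij_betw_same_card by metis
  also have "\<dots> = (\<Sum>s = 1..N. s * card (ord_idems (a + s) b m))"
    unfolding D_def by (subst card_SigmaI) (auto simp: finite_ord_idems card_cartesian_product)
  finally show ?thesis
    by (simp add: b_def)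
qed

text \<open>The block recursion, solved by \<open>sum_weighted_choose\<close>. For
  \<open>m = 1\<close> the remainder has rank \<open>0\<close>, so only \<open>s = N\<close>
  contributes.\<close>

lemma card_ord_idems:
  "m > 0 \<Longrightarrow> card (ord_idems a (a + N) m) = (N + m - 1) choose (2 * m - 1)"
proof (induction m arbitrary: a N rule: nat_induct_non_zero)
  case 1
  have "card (ord_idems a (a + N) (Suc 0)) = (\<Sum>s = 1..N. if s = N then N else 0)"
    unfolding card_ord_idems_Suc
  proof (rule sum.cong)
    fix s assume s: "s \<in> {1..N}"
    then have "a + N = (a + s) + (N - s)"
      by simp
    then show "s * card (ord_idems (a + s) (a + N) 0) = (if s = N then N else 0)"
      using card_ord_idems_0[of "a + s" "N - s"] s by auto
  qed simp
  then show ?case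
    by simp
next
  case (Suc m)
  have "card (ord_idems a (a + N) (Suc m)) = (\<Sum>s = 1..N. s * ((N - s + m - 1) choose (2 * m - 1)))"
    unfolding card_ord_idems_Suc
  proof (rule sum.cong)
    fix s assume "s \<in> {1..N}"
    then have "a + N = (a + s) + (N - s)"
      by simp
    then show "s * card (ord_idems (a + s) (a + N) m) = s * ((N - s + m - 1) choose (2 * m - 1))"
      using Suc.IH[of "a + s" "N - s"] by simp
  qed simp
  then show ?case
    using sum_weighted_choose[OF Suc.hyps] by simp
qed

section \<open>Orientation-preserving idempotents by rank\<close>

definition rank_idems :: "nat \<Rightarrow> nat \<Rightarrow> (nat \<Rightarrow> nat) set" where
  "rank_idems n k = {e \<in> idems n. card (e ` {1..n}) = k}"

lemma finite_idems: "finite (idems n)"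
  using finite_OP[of n] by (auto simp: idems_def)

text \<open>Rank one means constant. It is treated apart because the decomposition for higher rank
  has a nonempty complement of the block of \<open>1\<close>.\<close>

lemma card_rank_idems_1:
  assumes n: "n > 0"
  shows "card (rank_idems n 1) = n"
proof -
  have "rank_idems n 1 = const_map n ` {1..n}"
  proof
    show "rank_idems n 1 \<subseteq> const_map n ` {1..n}"
    proof
      fix e assume e: "e \<in> rank_idems n 1"
      then have eC: "e \<in> carrier (OP n)"
        by (auto simp: rank_idems_def idems_def)
      obtain v where v: "e ` {1..n} = {v}"
        using e card_1_singletonE by (auto simp: rank_idems_def)
      have v': "v \<in> {1..n}"
        using v OP_mem[OF eC] n by (metis atLeastAtMost_iff imageE insertI1)
      have "e = const_map n v"
        by (rule OP_ext[OF eC const_map_in_OP[OF v']]) (use v in \<open>auto simp: const_map_def\<close>)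
      then show "e \<in> const_map n ` {1..n}"
        using v' by blast
    qed
    show "const_map n ` {1..n} \<subseteq> rank_idems n 1"
    proof (rule image_subsetI)
      fix v assume v: "v \<in> {1..n}"
      have "const_map n v ` {1..n} = {v}"
        using n by (force simp: const_map_def)
      then show "const_map n v \<in> rank_idems n 1"
        using const_map_in_OP[OF v] v idems_iff[OF n] by (simp add: rank_idems_def) (simp add: const_map_def)
    qed
  qed
  moreover have "inj_on (const_map n) {1..n}"
    using const_map_eq_iff[OF n] by (simp add: inj_on_def)
  ultimately show ?thesis
    by (simp add: card_image)
qed

text \<open>The block of \<open>1\<close> is a cyclic interval of some size \<open>i\<close>, ending at some \<open>q \<in> {1..i}\<close>; on the
  complementary interval of \<open>N = n - i\<close> points the idempotent is order-preserving.\<close>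

definition cyc_glue :: "nat \<Rightarrow> nat \<times> nat \<times> nat \<times> (nat \<Rightarrow> nat) \<Rightarrow> nat \<Rightarrow> nat" where
  "cyc_glue n = (\<lambda>(i, q, v, g). \<lambda>x\<in>{1..n}. if x \<in> {q + 1..<q + 1 + (n - i)} then g x else v)"

text \<open>\<open>q\<close> and \<open>v\<close> have \<open>i\<close> possible values each, as the
  block of \<open>1\<close> has \<open>i\<close> points and contains its own value; this is the
  source of the factor \<open>i^2\<close>.\<close>

definition cyc_data :: "nat \<Rightarrow> nat \<Rightarrow> (nat \<times> nat \<times> nat \<times> (nat \<Rightarrow> nat)) set" where
  "cyc_data n m = (SIGMA i:{1..<n}. SIGMA q:{1..i}.
     ({1..n} - {q + 1..<q + 1 + (n - i)}) \<times> ord_idems (q + 1) (q + 1 + (n - i)) m)"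

lemma cyc_glue_apply:
  "x \<in> {1..n} \<Longrightarrow> cyc_glue n (i, q, v, g) x = (if x \<in> {q + 1..<q + 1 + (n - i)} then g x else v)"
  by (simp add: cyc_glue_def)

lemma cyc_dataE:
  assumes "d \<in> cyc_data n m"
  obtains i q v g where "d = (i, q, v, g)" "i \<in> {1..<n}" "q \<in> {1..i}"
    "v \<in> {1..n}" "v \<notin> {q + 1..<q + 1 + (n - i)}" "g \<in> ord_idems (q + 1) (q + 1 + (n - i)) m"
  using assms that by (auto simp: cyc_data_def)

text \<open>\<open>v\<close> is the value at \<open>1\<close>, and the interval is where the value
  differs from \<open>v\<close>, because \<open>g\<close> stays inside its interval and
  \<open>v\<close> lies outside. The remaining data are read off from these.\<close>

lemma cyc_glue_inj: "inj_on (cyc_glue n) (cyc_data n m)"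
proof (rule inj_onI)
  fix d d' assume "d \<in> cyc_data n m" "d' \<in> cyc_data n m" and eq: "cyc_glue n d = cyc_glue n d'"
  then obtain i q v g i' q' v' g' where
    d: "d = (i, q, v, g)" "i \<in> {1..<n}" "q \<in> {1..i}" "v \<in> {1..n}" "v \<notin> {q + 1..<q + 1 + (n - i)}"
      "g \<in> ord_idems (q + 1) (q + 1 + (n - i)) m" and
    d': "d' = (i', q', v', g')" "i' \<in> {1..<n}" "q' \<in> {1..i'}" "v' \<in> {1..n}"
      "v' \<notin> {q' + 1..<q' + 1 + (n - i')}" "g' \<in> ord_idems (q' + 1) (q' + 1 + (n - i')) m"
    by (metis cyc_dataE)
  let ?I = "{q + 1..<q + 1 + (n - i)}" and ?I' = "{q' + 1..<q' + 1 + (n - i')}"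
  have n: "1 \<in> {1..n}"
    using d by auto
  have eqx: "(if x \<in> ?I then g x else v) = (if x \<in> ?I' then g' x else v')" if "x \<in> {1..n}" for x
    using eq d(1) d'(1) cyc_glue_apply[OF that] by metis
  have vv: "v = v'"
    using eqx[OF n] d(3) d'(3) by simp
  have inner: "g x \<noteq> v" if "x \<in> ?I" for x
    using ord_idemsD(1,2)[OF d(6) that] d(5) by auto
  have inner': "g' x \<noteq> v'" if "x \<in> ?I'" for x
    using ord_idemsD(1,2)[OF d'(6) that] d'(5) by auto
  have sub: "?I \<subseteq> {1..n}" "?I' \<subseteq> {1..n}"
    using d(2,3) d'(2,3) by auto
  have II: "?I = ?I'"
  proof (rule Set.set_eqI)
    fix x show "x \<in> ?I \<longleftrightarrow> x \<in> ?I'"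
      using eqx[of x] inner[of x] inner'[of x] vv sub by (metis subsetD)
  qed
  then have "q + 1 = q' + 1 \<and> q + 1 + (n - i) = q' + 1 + (n - i')"
    using atLeastLessThan_eq_iff[of "q + 1" "q + 1 + (n - i)" "q' + 1" "q' + 1 + (n - i')"] d(2) d'(2)
    by auto
  then have iq: "i = i'" "q = q'"
    using d(2) d'(2) by auto
  have "g = g'"
  proof (rule extensionalityI[of _ ?I])
    show "g x = g' x" if "x \<in> ?I" for x
      using eqx[of x] that II sub by (metis subsetD)
  qed (use ord_idemsD(6)[OF d(6)] ord_idemsD(6)[OF d'(6)] II in auto)
  then show "d = d'"
    using d(1) d'(1) iq vv by simp
qed

lemma cyc_glue_into:
  assumes "d \<in> cyc_data n m"
  shows "cyc_glue n d \<in> rank_idems n (Suc m)"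
proof -
  obtain i q v g where d: "d = (i, q, v, g)" and iq: "i \<in> {1..<n}" "q \<in> {1..i}"
    and v: "v \<in> {1..n}" "v \<notin> {q + 1..<q + 1 + (n - i)}"
    and g: "g \<in> ord_idems (q + 1) (q + 1 + (n - i)) m"
    using assms by (rule cyc_dataE)
  define p where "p = q + 1 + (n - i)"
  note gD = ord_idemsD[OF g, folded p_def]
  have n: "n > 0" and p: "q + 1 < p" "p \<le> n + 1"
    using iq by (auto simp: p_def)
  let ?f = "\<lambda>x. if x \<in> {q + 1..<p} then g x else v"
  have mem: "?f x \<in> {1..n}" if "x \<in> {1..n}" for x
    using gD(1,2)[of x] v p that iq by auto
  \<comment> \<open>The only possible descent is at the right end of the interval when
    \<open>v\<close> lies left of it, and at the left end when \<open>v\<close> lies right of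
    it.\<close>
  have "\<exists>F. is_lift n n F ?f"
  proof (cases "v \<le> q")
    case True
    show ?thesis
    proof (rule split_seq_has_lift[OF n n mem, where j = "p - 1"])
      show "?f x \<le> ?f (x + 1)" if "x \<in> {1..<n}" "x \<noteq> p - 1" for x
        using that True gD(1)[of "x + 1"] gD(4)[of x "x + 1"] p by auto
      show "?f n \<le> ?f 1" if "p - 1 < n"
        using that p iq by auto
    qed
  next
    case False
    then have vp: "p \<le> v"
      using v p by (auto simp: p_def)
    show ?thesis
    proof (rule split_seq_has_lift[OF n n mem, where j = q])
      show "?f x \<le> ?f (x + 1)" if "x \<in> {1..<n}" "x \<noteq> q" for x
        using that vp gD(2)[of x] gD(4)[of x "x + 1"] p by auto
      show "?f n \<le> ?f 1" if "q < n"
        using that vp v p iq by auto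
    qed
  qed
  then have C: "cyc_glue n d \<in> carrier (OP n)"
    using restrict_in_OP[OF n] by (auto simp: d cyc_glue_def p_def)
  have ap: "cyc_glue n d x = ?f x" if "x \<in> {1..n}" for x
    unfolding d p_def using cyc_glue_apply[OF that] .
  have "cyc_glue n d (cyc_glue n d x) = cyc_glue n d x" if x: "x \<in> {1..n}" for x
    using ap[OF x] ap[OF mem[OF x]] gD(1,2,3)[of x] v by (auto simp: p_def)
  then have idem: "cyc_glue n d \<in> idems n"
    using C idems_iff[OF n] by blast
  have split: "{1..n} = {q + 1..<p} \<union> ({1..n} - {q + 1..<p})"
    using p iq by auto
  have "cyc_glue n d ` {q + 1..<p} = g ` {q + 1..<p}"
    using ap p iq by (intro image_cong) auto
  moreover have "cyc_glue n d ` ({1..n} - {q + 1..<p}) = {v}"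
  proof -
    have "cyc_glue n d x = v" if "x \<in> {1..n} - {q + 1..<p}" for x
      using ap[of x] that by auto
    moreover have "1 \<in> {1..n} - {q + 1..<p}"
      using n iq by auto
    ultimately show ?thesis
      by blast
  qed
  ultimately have "cyc_glue n d ` {1..n} = insert v (g ` {q + 1..<p})"
    by (subst split) (simp only: image_Un Un_insert_right sup_bot_right)
  moreover have "v \<notin> g ` {q + 1..<p}"
    using gD(1,2) v by (auto simp: p_def)
  ultimately have "card (cyc_glue n d ` {1..n}) = Suc m"
    using gD(5) by simp
  then show ?thesis
    using idem by (simp add: rank_idems_def)
qed

text \<open>Normalise the lift by \<open>F 1 = v\<close>. On \<open>{1..n}\<close> its values lie
  between \<open>v\<close> and \<open>v + n\<close>, and \<open>f x = v\<close> holds exactly at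
  these two extremes, so by monotonicity the other points form an interval \<open>D\<close>.\<close>

lemma cyc_glue_onto:
  assumes m: "m > 0" and f: "f \<in> rank_idems n (Suc m)"
  shows "f \<in> cyc_glue n ` cyc_data n m"
proof -
  have n: "n > 0"
    using f m by (cases n) (auto simp: rank_idems_def)
  have fC: "f \<in> carrier (OP n)" and ff: "\<And>x. x \<in> {1..n} \<Longrightarrow> f (f x) = f x"
    and rank: "card (f ` {1..n}) = Suc m"
    using f idems_iff[OF n] by (auto simp: rank_idems_def)
  have one: "1 \<in> {1..n}"
    using n by simp
  define v where "v = f 1"
  have v: "v \<in> {1..n}"
    unfolding v_def using OP_mem[OF fC one] .
  have "f (wrap n 1) = wrap n (int v)"
    using v wrap_of_nat[OF one] by (simp add: v_def)
  then obtain F where F: "is_lift n n F f" and F1: "F 1 = int v"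
    using OP_liftE[OF n fC] by blast
  have Fx: "wrap n (F (int x)) = f x" if "x \<in> {1..n}" for x
    using is_lift_wrap[OF F n, of "int x"] that by simp
  have bounds: "int v \<le> F (int x)" "F (int x) \<le> int v + int n" if "x \<in> {1..n}" for x
    using is_liftD(1)[OF F, of 1 "int x"] is_liftD(1)[OF F, of "int x" "1 + int n"]
      is_liftD(2)[OF F, of 1] F1 that by auto
  have block: "f x = v \<longleftrightarrow> F (int x) = int v \<or> F (int x) = int v + int n" if x: "x \<in> {1..n}" for x
  proof
    assume "f x = v"
    then have "wrap n (F (int x)) = wrap n (int v)"
      using Fx[OF x] v by simp
    then show "F (int x) = int v \<or> F (int x) = int v + int n"
      using wrap_eq_window[OF n, of "F (int x)" "int v"] bounds[OF x] by linarith
  next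
    assume "F (int x) = int v \<or> F (int x) = int v + int n"
    then show "f x = v"
      using Fx[OF x] v by auto
  qed
  define D where "D = {x \<in> {1..n}. f x \<noteq> v}"
  have finD: "finite D"
    by (simp add: D_def)
  have "D \<noteq> {}"
  proof
    assume "D = {}"
    then have "f ` {1..n} \<subseteq> {v}"
      by (auto simp: D_def)
    then have "card (f ` {1..n}) \<le> 1"
      using card_mono[of "{v}"] by fastforce
    then show False
      using rank m by simp
  qed
  define q where "q = Min D - 1"
  define p where "p = Max D + 1"
  have Min: "Min D \<in> D" "\<And>x. x \<in> D \<Longrightarrow> Min D \<le> x" and Max: "Max D \<in> D" "\<And>x. x \<in> D \<Longrightarrow> x \<le> Max D"
    using finD \<open>D \<noteq> {}\<close> by auto
  have "Min D \<noteq> 1"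
    using Min(1) by (auto simp: D_def v_def)
  then have q: "q \<ge> 1" "q + 1 = Min D"
    using Min(1) by (auto simp: D_def q_def)
  have p: "q + 1 < p" "p \<le> n + 1"
    using Max q(2) Min by (auto simp: D_def p_def le_imp_less_Suc)
  have D_eq: "D = {q + 1..<p}"
  proof
    show "D \<subseteq> {q + 1..<p}"
      using q Min Max by (auto simp: p_def le_imp_less_Suc)
    show "{q + 1..<p} \<subseteq> D"
    proof
      fix x assume x: "x \<in> {q + 1..<p}"
      then have le: "Min D \<le> x" "x \<le> Max D" and xn: "x \<in> {1..n}"
        using q p by (auto simp: p_def)
      have mm: "Min D \<in> {1..n}" "Max D \<in> {1..n}" "f (Min D) \<noteq> v" "f (Max D) \<noteq> v"
        using Min(1) Max(1) by (auto simp: D_def)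
      have "F (int (Min D)) \<le> F (int x)" "F (int x) \<le> F (int (Max D))"
        using le by (auto intro!: is_liftD(1)[OF F])
      then have "f x \<noteq> v"
        using block[OF xn] block[OF mm(1)] block[OF mm(2)] mm(3,4) bounds[OF mm(1)] bounds[OF mm(2)]
        by auto
      then show "x \<in> D"
        using xn by (simp add: D_def)
    qed
  qed
  have fD: "f x \<in> D" if "x \<in> D" for x
    using that ff[of x] OP_mem[OF fC, of x] by (auto simp: D_def)
  \<comment> \<open>Strictly between \<open>v\<close> and \<open>v + n\<close> a residue has only
    one representative: \<open>f x\<close> itself if it exceeds \<open>v\<close>, otherwise
    \<open>f x + n\<close>.\<close>
  have low_or_high: "F (int x) = int (f x) \<and> f x > v \<or> F (int x) = int (f x) + int n \<and> f x < v"
    if x: "x \<in> D" for x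
  proof -
    have xn: "x \<in> {1..n}" "f x \<noteq> v" and fx: "f x \<in> {1..n}"
      using x OP_mem[OF fC, of x] by (auto simp: D_def)
    have strict: "int v < F (int x)" "F (int x) < int v + int n"
      using block[OF xn(1)] bounds[OF xn(1)] xn(2) by auto
    have eq: "wrap n (F (int x)) = wrap n (int (f x))" "wrap n (F (int x)) = wrap n (int (f x) + int n)"
      using Fx[OF xn(1)] fx by auto
    show ?thesis
    proof (cases "F (int x) \<le> int n")
      case True
      then have "\<bar>F (int x) - int (f x)\<bar> < int n"
        using strict v fx by auto
      then show ?thesis
        using wrap_eq_window[OF n eq(1)] strict by linarith
    next
      case False
      then have "\<bar>F (int x) - (int (f x) + int n)\<bar> < int n"
        using strict v fx by auto
      then show ?thesis
        using wrap_eq_window[OF n eq(2)] strict by linarith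
    qed
  qed
  \<comment> \<open>A descent inside \<open>D\<close> would need \<open>f x > v > f y\<close>. The
    lift sends these two fixed points to \<open>f x\<close> and \<open>f y + n\<close>, in the wrong
    order.\<close>
  have mono: "f x \<le> f y" if "x \<in> D" "y \<in> D" "x \<le> y" for x y
  proof (rule ccontr)
    assume less: "\<not> f x \<le> f y"
    have "F (int x) \<le> F (int y)"
      using that by (intro is_liftD(1)[OF F]) auto
    then have xy: "f x > v" "f y < v"
      using low_or_high[OF that(1)] low_or_high[OF that(2)] less by auto
    have "f (f x) = f x" "f (f y) = f y"
      using ff that by (auto simp: D_def)
    then have "F (int (f x)) = int (f x)" "F (int (f y)) = int (f y) + int n"
      using low_or_high[OF fD[OF that(1)]] low_or_high[OF fD[OF that(2)]] xy by auto
    moreover have "F (int (f y)) \<le> F (int (f x))"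
      using less by (intro is_liftD(1)[OF F]) auto
    moreover have "f x \<in> {1..n}" "f y \<in> {1..n}"
      using fD[OF that(1)] fD[OF that(2)] by (auto simp: D_def)
    ultimately show False
      by auto
  qed
  \<comment> \<open>\<open>D\<close> has \<open>p - (q + 1)\<close> points; \<open>i\<close> counts
    the others.\<close>
  define i where "i = n + 1 + q - p"
  have i: "i \<in> {1..<n}" "q \<in> {1..i}" "q + 1 + (n - i) = p"
    using p q by (auto simp: i_def)
  define g where "g = restrict f D"
  have im: "f ` {1..n} = insert v (g ` D)"
  proof -
    have "f ` {1..n} = f ` D \<union> f ` ({1..n} - D)"
      by (auto simp: D_def)
    also have "f ` ({1..n} - D) = {v}"
      using one by (force simp: D_def v_def)
    finally show ?thesis
      by (simp add: g_def)
  qed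
  have "v \<notin> g ` D"
    by (auto simp: g_def D_def)
  then have card: "card (g ` D) = m"
    using im rank finD by simp
  have "g \<in> ord_idems (q + 1) p m"
  proof (rule ord_idemsI[of _ "q + 1" p, folded D_eq, OF _ _ _ _ card])
    show "g \<in> extensional D"
      by (simp add: g_def)
    show "g x \<in> D" if "x \<in> D" for x
      using fD[OF that] that by (simp add: g_def)
    show "g x \<le> g y" if "x \<in> D" "y \<in> D" "x \<le> y" for x y
      using mono[OF that] that by (simp add: g_def)
    show "g (g x) = g x" if "x \<in> D" for x
      using that fD[OF that] ff[of x] by (simp add: g_def) (simp add: D_def)
  qed
  moreover have "v \<notin> {q + 1..<p}"
    using ff[OF one] unfolding D_eq[symmetric] by (auto simp: D_def v_def)
  ultimately have "(i, q, v, g) \<in> cyc_data n m"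
    using i v by (simp add: cyc_data_def)
  moreover have "f = cyc_glue n (i, q, v, g)"
  proof (rule extensionalityI[of _ "{1..n}"])
    show "f \<in> extensional {1..n}"
      using fC by (auto simp: OP_def PiE_def)
    show "f x = cyc_glue n (i, q, v, g) x" if x: "x \<in> {1..n}" for x
      using cyc_glue_apply[OF x, of i q v g] x unfolding i(3) D_eq[symmetric]
      by (auto simp: g_def D_def)
  qed (simp add: cyc_glue_def)
  ultimately show ?thesis
    by blast
qed

lemma card_rank_idems:
  assumes "k \<ge> 2"
  shows "card (rank_idems n k) = (\<Sum>i = 1..<n. i\<^sup>2 * ((n - i + k - 2) choose (2 * k - 3)))"
proof -
  \<comment> \<open>Besides \<open>v\<close> the idempotent has \<open>k - 1\<close> values, all
    taken on the interval.\<close>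
  define m where "m = k - 1"
  have m: "m > 0" "k = Suc m"
    using assms by (auto simp: m_def)
  have "bij_betw (cyc_glue n) (cyc_data n m) (rank_idems n k)"
    unfolding bij_betw_def m(2) using cyc_glue_inj cyc_glue_into cyc_glue_onto[OF m(1)] by blast
  then have "card (rank_idems n k) = card (cyc_data n m)"
    using bij_betw_same_card by metis
  also have "\<dots> = (\<Sum>i = 1..<n. \<Sum>q = 1..i. i * ((n - i + m - 1) choose (2 * m - 1)))"
  proof -
    have "card (({1..n} - {q + 1..<q + 1 + (n - i)}) \<times> ord_idems (q + 1) (q + 1 + (n - i)) m) =
        i * ((n - i + m - 1) choose (2 * m - 1))" if "i \<in> {1..<n}" "q \<in> {1..i}" for i q
    proof -
      have "card ({1..n} - {q + 1..<q + 1 + (n - i)}) = i"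
        using that by (subst card_Diff_subset) auto
      then show ?thesis
        using card_ord_idems[OF m(1), of "q + 1" "n - i"] by (simp add: card_cartesian_product)
    qed
    then show ?thesis
      unfolding cyc_data_def
      by (subst card_SigmaI; (subst card_SigmaI)?) (auto simp: finite_ord_idems intro!: sum.cong)
  qed
  also have "\<dots> = (\<Sum>i = 1..<n. i\<^sup>2 * ((n - i + k - 2) choose (2 * k - 3)))"
    using m by (simp add: power2_eq_square mult.assoc eval_nat_numeral)
  finally show ?thesis .
qed

section \<open>Summation over ranks\<close>

lemma idems_rank_decomp:
  assumes "n > 0"
  shows "idems n = (\<Union>k\<in>{1..n}. rank_idems n k)"
proof -
  have "card (e ` {1..n}) \<in> {1..n}" if "e \<in> idems n" for e
  proof -
    have "card (e ` {1..n}) \<le> n"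
      using card_image_le[of "{1..n}" e] by simp
    moreover have "card (e ` {1..n}) > 0"
      using assms by (simp add: card_gt_0_iff)
    ultimately show ?thesis
      by simp
  qed
  then show ?thesis
    by (auto simp: rank_idems_def)
qed

text \<open>A weight depending only on the rank is needed twice: constantly \<open>1\<close> to
  count idempotents, and the number of idempotents below \<open>e\<close> to count pairs.\<close>

lemma sum_over_idems:
  fixes w :: "nat \<Rightarrow> int"
  assumes "n > 0"
  shows "(\<Sum>e\<in>idems n. w (card (e ` {1..n}))) =
    int n * w 1 + (\<Sum>k = 2..n. \<Sum>i = 1..<n. (int i)\<^sup>2 * int ((n - i + k - 2) choose (2 * k - 3)) * w k)"
proof -
  have "(\<Sum>e\<in>idems n. w (card (e ` {1..n}))) =
      (\<Sum>k = 1..n. \<Sum>e\<in>rank_idems n k. w (card (e ` {1..n})))"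
    unfolding idems_rank_decomp[OF assms]
    by (rule sum.UNION_disjoint) (auto simp: rank_idems_def finite_idems)
  also have "\<dots> = (\<Sum>k = 1..n. int (card (rank_idems n k)) * w k)"
    by (intro sum.cong) (auto simp: rank_idems_def)
  also have "\<dots> = int n * w 1 + (\<Sum>k = 2..n. int (card (rank_idems n k)) * w k)"
    using assms card_rank_idems_1[OF assms] by (simp add: sum.atLeast_Suc_atMost numeral_2_eq_2)
  also have "(\<Sum>k = 2..n. int (card (rank_idems n k)) * w k) =
      (\<Sum>k = 2..n. \<Sum>i = 1..<n. (int i)\<^sup>2 * int ((n - i + k - 2) choose (2 * k - 3)) * w k)"
    by (intro sum.cong) (auto simp: card_rank_idems sum_distrib_right)
  finally show ?thesis .
qed

lemma card_idems:
  assumes "n > 0"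
  shows "int (card (idems n)) =
    int (fib (2 * n - 1)) + int (fib (2 * n + 1)) - (int n)\<^sup>2 + int n - 2"
  using sum_over_idems[OF assms, of "\<lambda>_. 1"] sum_square_choose_eq_fib[OF assms] by simp

theorem theorem3p3:
  fixes n :: nat
  assumes "n \<ge> 3"
  shows "int (card (semigroup_endos (OP n))) =
    3 * int n +
    (\<Sum>k = 2..n. \<Sum>i = 1..n - k + 1.
       (int i)\<^sup>2 * int ((n - i + k - 2) choose (2 * k - 3)) *
       (int (fib (2 * k - 1)) + int (fib (2 * k + 1)) - (int k)\<^sup>2 + int k - 2))"
proof -
  have n: "n > 0"
    using assms by simp
  \<comment> \<open>The fibre over \<open>e\<close> consists of the idempotents below
    \<open>e\<close>, whose number depends only on the rank of \<open>e\<close>.\<close>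
  have "card (idem_pairs n) = (\<Sum>e\<in>idems n. card (idems (card (e ` {1..n}))))"
    unfolding idem_pairs_def
    by (subst card_SigmaI) (auto simp: finite_idems card_idems_below[OF n])
  then have "int (card (idem_pairs n)) = (\<Sum>e\<in>idems n. int (card (idems (card (e ` {1..n})))))"
    by simp
  also have "\<dots> = int n * int (card (idems 1)) + (\<Sum>k = 2..n. \<Sum>i = 1..<n.
      (int i)\<^sup>2 * int ((n - i + k - 2) choose (2 * k - 3)) * int (card (idems k)))"
    by (rule sum_over_idems[OF n])
  \<comment> \<open>A constant has only itself below it; these \<open>n\<close> pairs join the
    \<open>2 * n\<close> conjugations to give \<open>3 * n\<close>.\<close>
  also have "int (card (idems 1)) = 1"
    using card_idems[of 1] by (simp add: eval_nat_numeral)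
  also have "(\<Sum>k = 2..n. \<Sum>i = 1..<n.
      (int i)\<^sup>2 * int ((n - i + k - 2) choose (2 * k - 3)) * int (card (idems k))) =
    (\<Sum>k = 2..n. \<Sum>i = 1..n - k + 1. (int i)\<^sup>2 * int ((n - i + k - 2) choose (2 * k - 3)) *
       (int (fib (2 * k - 1)) + int (fib (2 * k + 1)) - (int k)\<^sup>2 + int k - 2))"
  proof (rule sum.cong[OF refl])
    fix k assume k: "k \<in> {2..n}"
    let ?w = "int (fib (2 * k - 1)) + int (fib (2 * k + 1)) - (int k)\<^sup>2 + int k - 2"
    have "(\<Sum>i = 1..<n. (int i)\<^sup>2 * int ((n - i + k - 2) choose (2 * k - 3)) * int (card (idems k))) =
        (\<Sum>i = 1..<n. (int i)\<^sup>2 * int ((n - i + k - 2) choose (2 * k - 3)) * ?w)"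
      using k card_idems[of k] by simp
    \<comment> \<open>For \<open>i > n - k + 1\<close> the upper index drops below
      \<open>2 * k - 3\<close>.\<close>
    also have "\<dots> = (\<Sum>i = 1..n - k + 1. (int i)\<^sup>2 * int ((n - i + k - 2) choose (2 * k - 3)) * ?w)"
      by (rule sum.mono_neutral_right) (use k in \<open>auto simp: binomial_eq_0\<close>)
    finally show "(\<Sum>i = 1..<n. (int i)\<^sup>2 * int ((n - i + k - 2) choose (2 * k - 3)) * int (card (idems k))) =
        (\<Sum>i = 1..n - k + 1. (int i)\<^sup>2 * int ((n - i + k - 2) choose (2 * k - 3)) * ?w)" .
  qed
  finally show ?thesis
    using card_semigroup_endos_OP[OF assms] by simp
qed

end
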